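(* Let $G$ be a complete convex geometric graph and let $B$ be a subgraph of $G$. If $B$ is a blocker for $\mathcal{T}_{\leq 3}(G)$, then $B$ is a comb of $G$.
   Context: A geometric graph is a graph whose vertices are points in the plane in general position (no three collinear) and whose edges are straight segments between pairs of vertices; $G$ is complete if all pairs of vertices are joined, and convex if its vertices are in convex position. A geometric graph is simple if no two of its edges cross. $\mathcal{T}_{\leq k}(G)$ denotes the family of all simple (non-crossing) spanning trees of $G$ of (graph) diameter at most $k$. For a family $\mathcal{F}$ of subgraphs of $G$, a subgraph $B$ blocks $\mathcal{F}$ if it shares at least one edge with every member of $\mathcal{F}$; a blocker of $\mathcal{F}$ is a subgraph that blocks $\mathcal{F}$ and has the smallest possible number of edges among all subgraphs blocking $\mathcal{F}$. A comb of $G$ is a simple spanning subgraph $B$ of $G$ such that: (1) the intersection of $B$ with the boundary of $\mathrm{conv}(V(G))$ is a simple path $P$; (2) each vertex in $V(G)\setminus P$ is connected by a unique edge of $B$ to an interior (non-endpoint) vertex of $P$; (3) for each edge $e$ of $B$, the line spanned by $e$ does not cross any edge of $B$. *)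

theory Defs
  imports "HOL-Analysis.Analysis"
begin

type_synonym pt = "real \<times> real"
type_synonym edge = "pt set"

definition general_position :: "pt set \<Rightarrow> bool" where
  "general_position V \<longleftrightarrow>
     (\<forall>a\<in>V. \<forall>b\<in>V. \<forall>c\<in>V. distinct [a, b, c] \<longrightarrow> \<not> collinear {a, b, c})"

definition convex_position :: "pt set \<Rightarrow> bool" where
  "convex_position V \<longleftrightarrow> (\<forall>v\<in>V. v \<notin> convex hull (V - {v}))"

definition complete_edges :: "pt set \<Rightarrow> edge set" where
  "complete_edges V = {{a, b} | a b. a \<in> V \<and> b \<in> V \<and> a \<noteq> b}"

definition seg_cross :: "edge \<Rightarrow> edge \<Rightarrow> bool" where
  "seg_cross e f \<longleftrightarrow> (\<exists>a b c d. e = {a, b} \<and> f = {c, d} \<and> a \<noteq> b \<and> c \<noteq> d \<and>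
      {a, b} \<inter> {c, d} = {} \<and> closed_segment a b \<inter> closed_segment c d \<noteq> {})"

definition simple_geo :: "edge set \<Rightarrow> bool" where
  "simple_geo E \<longleftrightarrow> (\<forall>e\<in>E. \<forall>f\<in>E. \<not> seg_cross e f)"

definition walk :: "edge set \<Rightarrow> pt list \<Rightarrow> bool" where
  "walk E xs \<longleftrightarrow> xs \<noteq> [] \<and> (\<forall>i. Suc i < length xs \<longrightarrow> {xs ! i, xs ! Suc i} \<in> E)"

definition graph_connected :: "pt set \<Rightarrow> edge set \<Rightarrow> bool" where
  "graph_connected V E \<longleftrightarrow>
     (\<forall>u\<in>V. \<forall>v\<in>V. \<exists>xs. walk E xs \<and> hd xs = u \<and> last xs = v)"

definition has_cycle :: "edge set \<Rightarrow> bool" where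
  "has_cycle E \<longleftrightarrow> (\<exists>xs. length xs \<ge> 3 \<and> distinct xs \<and> walk E xs \<and> {last xs, hd xs} \<in> E)"

definition spanning_tree :: "pt set \<Rightarrow> edge set \<Rightarrow> edge set \<Rightarrow> bool" where
  "spanning_tree V E T \<longleftrightarrow> T \<subseteq> E \<and> graph_connected V T \<and> \<not> has_cycle T"

definition diameter_le :: "pt set \<Rightarrow> edge set \<Rightarrow> nat \<Rightarrow> bool" where
  "diameter_le V T k \<longleftrightarrow>
     (\<forall>u\<in>V. \<forall>v\<in>V. \<exists>xs. walk T xs \<and> hd xs = u \<and> last xs = v \<and> length xs \<le> k + 1)"

definition trees_le :: "pt set \<Rightarrow> nat \<Rightarrow> edge set set" where
  "trees_le V k = {T. spanning_tree V (complete_edges V) T \<and> simple_geo T \<and> diameter_le V T k}"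

definition blocks :: "edge set set \<Rightarrow> edge set \<Rightarrow> bool" where
  "blocks F B \<longleftrightarrow> (\<forall>T\<in>F. B \<inter> T \<noteq> {})"

definition is_blocker :: "pt set \<Rightarrow> edge set set \<Rightarrow> edge set \<Rightarrow> bool" where
  "is_blocker V F B \<longleftrightarrow> B \<subseteq> complete_edges V \<and> blocks F B \<and>
     (\<forall>B'. B' \<subseteq> complete_edges V \<and> blocks F B' \<longrightarrow> card B \<le> card B')"

definition boundary_edges :: "pt set \<Rightarrow> edge set" where
  "boundary_edges V = {e \<in> complete_edges V.
      \<exists>a b. e = {a, b} \<and> closed_segment a b \<subseteq> frontier (convex hull V)}"

definition path_edges :: "pt list \<Rightarrow> edge set" where
  "path_edges ps = {{ps ! i, ps ! Suc i} | i. Suc i < length ps}"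

definition interior_vertices :: "pt list \<Rightarrow> pt set" where
  "interior_vertices ps = {ps ! i | i. 0 < i \<and> Suc i < length ps}"

definition line_crosses :: "edge \<Rightarrow> edge \<Rightarrow> bool" where
  "line_crosses e f \<longleftrightarrow> (\<exists>a b c d. e = {a, b} \<and> f = {c, d} \<and> a \<noteq> b \<and> c \<noteq> d \<and>
      \<not> f \<subseteq> affine hull {a, b} \<and> open_segment c d \<inter> affine hull {a, b} \<noteq> {})"

definition comb :: "pt set \<Rightarrow> edge set \<Rightarrow> bool" where
  "comb V B \<longleftrightarrow> B \<subseteq> complete_edges V \<and> simple_geo B \<and>
     (\<exists>ps. ps \<noteq> [] \<and> distinct ps \<and> set ps \<subseteq> V \<and>
        B \<inter> boundary_edges V = path_edges ps \<and>
        (\<forall>v \<in> V - set ps. \<exists>!e. e \<in> B \<and> (\<exists>w \<in> interior_vertices ps. e = {v, w}))) \<and>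
     (\<forall>e\<in>B. \<forall>f\<in>B. \<not> line_crosses e f)"

end

theory Submission
  imports Defs
begin

text \<open>
  A star meets every spanning tree, so a blocker has at most \<open>n - 1\<close> edges; as a star is itself
  a member of the family, no vertex is isolated in \<open>B\<close>, and hence \<open>B\<close> has a leaf \<open>v\<close>, with
  neighbour \<open>u\<close> say. For any other vertex \<open>a\<close>, consider the double star with central edge \<open>va\<close> in
  which the vertices of the boundary arc from \<open>u\<close> to \<open>a\<close> avoiding \<open>v\<close> hang on \<open>a\<close> and all others
  on \<open>v\<close>. Since \<open>B\<close> blocks it, some edge of \<open>B\<close> joins \<open>a\<close> to a vertex of that arc.
  These \<open>n - 2\<close> edges are distinct and different from \<open>vu\<close>, so they make up all of \<open>B\<close>: every
  vertex except \<open>u\<close> has a unique parent in the direction of \<open>u\<close>. Applying the same observation to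
  the other leaves of \<open>B\<close>, outermost first, shows that on either side of \<open>u\<close> the tree starts with
  a boundary path whose inner vertices (or \<open>u\<close>) are the parents of all remaining vertices, which
  are leaves with nested edges.
\<close>

subsection \<open>Orientation of point triples\<close>

text \<open>Twice the signed area of the triangle \<open>a b c\<close>, that is, the cross product
  of \<open>b - a\<close> and \<open>c - a\<close>; it is positive for a counterclockwise
  turn.\<close>

definition orient :: "pt \<Rightarrow> pt \<Rightarrow> pt \<Rightarrow> real" where
  "orient a b c = (fst b - fst a) * (snd c - snd a) - (snd b - snd a) * (fst c - fst a)"

lemma orient_rotate: "orient b c a = orient a b c"
  by (simp add: orient_def algebra_simps)

lemma orient_swap: "orient a c b = - orient a b c"
  by (simp add: orient_def algebra_simps)

lemma orient_same [simp]: "orient a b a = 0" "orient a b b = 0" "orient a a b = 0"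
  by (simp_all add: orient_def)

lemma orient_affine:
  assumes "u + v = 1"
  shows "orient a b (u *\<^sub>R c + v *\<^sub>R d) = u * orient a b c + v * orient a b d"
proof -
  have v: "v = 1 - u" using assms by simp
  show ?thesis unfolding v by (simp add: orient_def algebra_simps)
qed

text \<open>The factor \<open>t\<close> with \<open>c - b = t *\<^sub>R (a - b)\<close> is read off
  in a coordinate where \<open>a\<close> and \<open>b\<close> differ; the vanishing determinant
  makes the other coordinate agree.\<close>

lemma orient_eq_0_collinear:
  assumes "orient a b c = 0"
  shows "collinear {a, b, c}"
proof (cases "a = b")
  case True
  then show ?thesis by simp
next
  case False
  have eq: "(fst a - fst b) * (snd c - snd b) = (snd a - snd b) * (fst c - fst b)"
    using assms by (simp add: orient_def algebra_simps)
  have "\<exists>t. c - b = t *\<^sub>R (a - b)"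
  proof (cases "fst a = fst b")
    case True
    then have "snd a \<noteq> snd b" using False by (simp add: prod_eq_iff)
    then have "c - b = ((snd c - snd b) / (snd a - snd b)) *\<^sub>R (a - b)"
      using True eq by (simp add: prod_eq_iff)
    then show ?thesis ..
  next
    case False
    have "(fst c - fst b) / (fst a - fst b) * (snd a - snd b)
        = (fst a - fst b) * (snd c - snd b) / (fst a - fst b)"
      unfolding eq by simp
    then have "c - b = ((fst c - fst b) / (fst a - fst b)) *\<^sub>R (a - b)"
      using False by (simp add: prod_eq_iff)
    then show ?thesis ..
  qed
  then show ?thesis
    by (subst collinear_3) (auto simp: collinear_lemma)
qed

text \<open>The three orientations are unnormalised barycentric coordinates of \<open>v\<close>;
  dividing by their sum \<open>s\<close> gives a convex combination of the corners.\<close>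

lemma in_triangle:
  assumes "orient v y z > 0" "orient v z x > 0" "orient v x y > 0"
  shows "v \<in> convex hull {x, y, z}"
proof -
  define s where "s = orient v y z + orient v z x + orient v x y"
  have s: "s > 0" using assms by (simp add: s_def)
  have "s *\<^sub>R v = orient v y z *\<^sub>R x + orient v z x *\<^sub>R y + orient v x y *\<^sub>R z"
    by (simp add: s_def orient_def prod_eq_iff algebra_simps)
  then have "(1 / s) *\<^sub>R (s *\<^sub>R v) = (1 / s) *\<^sub>R (orient v y z *\<^sub>R x + orient v z x *\<^sub>R y + orient v x y *\<^sub>R z)"
    by simp
  then have "v = (orient v y z / s) *\<^sub>R x + (orient v z x / s) *\<^sub>R y + (orient v x y / s) *\<^sub>R z"
    using s by (simp add: scaleR_add_right)
  moreover have "orient v y z / s + orient v z x / s + orient v x y / s = 1"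
    using s by (simp add: s_def add_divide_distrib[symmetric])
  moreover have "orient v y z / s \<ge> 0" "orient v z x / s \<ge> 0" "orient v x y / s \<ge> 0"
    using assms s by simp_all
  ultimately show ?thesis
    unfolding convex_hull_3 mem_Collect_eq by (intro exI conjI)
qed

text \<open>The function \<open>orient a b\<close> is affine and vanishes on the line through
  \<open>a\<close> and \<open>b\<close>. With equal strict signs at \<open>c\<close> and
  \<open>d\<close> it cannot vanish on the segment between them.\<close>

lemma not_seg_cross_same_side:
  assumes "orient a b c * orient a b d > 0"
  shows "\<not> seg_cross {a, b} {c, d}"
proof
  assume "seg_cross {a, b} {c, d}"
  then have "closed_segment a b \<inter> closed_segment c d \<noteq> {}"
    unfolding seg_cross_def segment_convex_hull by auto
  then obtain z where z: "z \<in> closed_segment a b" "z \<in> closed_segment c d" by blast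
  obtain u where u: "0 \<le> u" "u \<le> 1" "z = (1 - u) *\<^sub>R a + u *\<^sub>R b"
    using z(1) by (auto simp: in_segment)
  obtain t where t: "0 \<le> t" "t \<le> 1" "z = (1 - t) *\<^sub>R c + t *\<^sub>R d"
    using z(2) by (auto simp: in_segment)
  have "orient a b z = 0" by (simp add: u(3) orient_affine)
  then have "(1 - t) * orient a b c + t * orient a b d = 0"
    by (simp add: t(3) orient_affine)
  \<comment> \<open>Multiplying by the sum of the two orientations yields nonnegative multiples of
    squares plus their positive product, which settles both signs at once.\<close>
  then have "((1 - t) * orient a b c + t * orient a b d) * (orient a b c + orient a b d) = 0"
    by simp
  then have *: "(1 - t) * (orient a b c)\<^sup>2 + t * (orient a b d)\<^sup>2 + orient a b c * orient a b d = 0"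
    by (simp add: algebra_simps power2_eq_square)
  have "(1 - t) * (orient a b c)\<^sup>2 \<ge> 0" "t * (orient a b d)\<^sup>2 \<ge> 0"
    using t by simp_all
  then show False using * assms by linarith
qed

text \<open>Here chords may share an endpoint. A zero of \<open>orient a b\<close> strictly between
  \<open>c\<close> and \<open>d\<close> forces both end values to vanish, so the whole segment lies
  on the line, which does not count as a crossing. The sign of \<open>s\<close> selects the
  side.\<close>

lemma not_line_crosses_weak_side:
  assumes "0 \<le> s * orient a b c" "0 \<le> s * orient a b d"
    and "orient a b c = 0 \<Longrightarrow> c \<in> {a, b}" "orient a b d = 0 \<Longrightarrow> d \<in> {a, b}"
    and s: "s \<noteq> 0"
  shows "\<not> line_crosses {a, b} {c, d}"
proof
  assume "line_crosses {a, b} {c, d}"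
  then obtain z where z: "z \<in> affine hull {a, b}" "z \<in> open_segment c d"
    and n: "\<not> {c, d} \<subseteq> affine hull {a, b}"
    by (auto simp: line_crosses_def doubleton_eq_iff open_segment_commute insert_commute)
  obtain u v where u: "u + v = 1" "z = u *\<^sub>R a + v *\<^sub>R b"
    using z(1) by (auto simp: affine_hull_2)
  obtain t where t: "0 < t" "t < 1" "z = (1 - t) *\<^sub>R c + t *\<^sub>R d"
    using z(2) by (auto simp: in_segment)
  have "orient a b z = 0" using u by (simp add: orient_affine)
  then have "(1 - t) * orient a b c + t * orient a b d = 0"
    by (simp add: t(3) orient_affine)
  then have "s * ((1 - t) * orient a b c + t * orient a b d) = 0" by simp
  then have "(1 - t) * (s * orient a b c) + t * (s * orient a b d) = 0"
    by (simp add: algebra_simps)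
  moreover have "(1 - t) * (s * orient a b c) \<ge> 0" "t * (s * orient a b d) \<ge> 0"
    using t assms by simp_all
  ultimately have "(1 - t) * (s * orient a b c) = 0" "t * (s * orient a b d) = 0"
    by linarith+
  then have "c \<in> {a, b}" "d \<in> {a, b}" using t s assms(3,4) by auto
  then have "{c, d} \<subseteq> affine hull {a, b}"
    by (auto intro: hull_inc)
  then show False using n by simp
qed

section \<open>Counterclockwise numbering of points in convex position\<close>

text \<open>Induction on the cardinality: an element that all others precede is removed, the rest is
  enumerated, and that element is put last.\<close>

lemma finite_strict_order_enumeration:
  fixes R :: "'a \<Rightarrow> 'a \<Rightarrow> bool"
  assumes "finite A"
    and "\<And>x y z. \<lbrakk>x \<in> A; y \<in> A; z \<in> A; R x y; R y z\<rbrakk> \<Longrightarrow> R x z"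
    and "\<And>x y. \<lbrakk>x \<in> A; y \<in> A; x \<noteq> y\<rbrakk> \<Longrightarrow> R x y \<or> R y x"
  shows "\<exists>p. bij_betw p {..<card A} A \<and> (\<forall>i j. i < j \<longrightarrow> j < card A \<longrightarrow> R (p i) (p j))"
  using assms
proof (induction "card A" arbitrary: A)
  case 0
  then show ?case by (auto simp: bij_betw_def)
next
  case (Suc n)
  have max: "\<exists>m\<in>C. \<forall>x\<in>C. x \<noteq> m \<longrightarrow> R x m" if "finite C" "C \<noteq> {}" "C \<subseteq> A" for C
    using that
  proof (induction rule: finite_ne_induct)
    case (singleton x)
    then show ?case by auto
  next
    case (insert x C)
    then obtain m where m: "m \<in> C" "\<forall>y\<in>C. y \<noteq> m \<longrightarrow> R y m" by auto
    have "x \<noteq> m" using m insert by auto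
    then consider "R x m" | "R m x" using Suc.prems(3) m insert by blast
    then show ?case
    proof cases
      case 1
      then show ?thesis using m by auto
    next
      case 2
      have "R y x" if "y \<in> C" for y
        using that m 2 Suc.prems(2)[of y m x] insert.prems by (cases "y = m") auto
      then show ?thesis by auto
    qed
  qed
  have "A \<noteq> {}" using Suc.hyps(2) by auto
  then obtain m where m: "m \<in> A" "\<forall>x\<in>A. x \<noteq> m \<longrightarrow> R x m"
    using max[of A] Suc.prems(1) by auto
  have card: "card (A - {m}) = n" using Suc.hyps(2) m Suc.prems(1) by simp
  have "\<exists>p. bij_betw p {..<card (A - {m})} (A - {m}) \<and>
      (\<forall>i j. i < j \<longrightarrow> j < card (A - {m}) \<longrightarrow> R (p i) (p j))"
  proof (rule Suc.hyps(1))
    show "n = card (A - {m})" "finite (A - {m})" using card Suc.prems(1) by simp_all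
    show "R x z" if "x \<in> A - {m}" "y \<in> A - {m}" "z \<in> A - {m}" "R x y" "R y z" for x y z
      using Suc.prems(2)[of x y z] that by blast
    show "R x y \<or> R y x" if "x \<in> A - {m}" "y \<in> A - {m}" "x \<noteq> y" for x y
      using Suc.prems(3)[of x y] that by blast
  qed
  then obtain p where p: "bij_betw p {..<n} (A - {m})" "\<forall>i j. i < j \<longrightarrow> j < n \<longrightarrow> R (p i) (p j)"
    using card by auto
  have mem: "p i \<in> A - {m}" if "i < n" for i using p(1) that by (auto simp: bij_betw_def)
  have "bij_betw (p(n := m)) ({..<n} \<union> {n}) ((A - {m}) \<union> {m})"
  proof (rule bij_betw_combine)
    show "bij_betw (p(n := m)) {..<n} (A - {m})"
      using p(1) by (subst bij_betw_cong[of _ _ p]) auto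
  qed auto
  moreover have "{..<n} \<union> {n} = {..<card A}" "(A - {m}) \<union> {m} = A"
    using Suc.hyps(2)[symmetric] m by auto
  moreover have "R ((p(n := m)) i) ((p(n := m)) j)" if "i < j" "j < card A" for i j
    using that p(2) mem[of i] m Suc.hyps(2)[symmetric] by (cases "j = n") auto
  ultimately show ?case by (intro exI[of _ "p(n := m)"]) simp
qed

text \<open>Since all increasing triples turn counterclockwise, sides of chords and crossings
  between chords become comparisons of indices.\<close>

locale ccw_polygon =
  fixes p :: "nat \<Rightarrow> pt" and n :: nat
  assumes inj: "inj_on p {..<n}"
    and ccw: "\<And>i j k. \<lbrakk>i < j; j < k; k < n\<rbrakk> \<Longrightarrow> 0 < orient (p i) (p j) (p k)"

text \<open>The points are sorted by angle around \<open>v\<close>. Convex position makes this order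
  transitive and also makes triples not containing \<open>v\<close> turn the right way, since each
  failure would put a point into a triangle of three others.\<close>

lemma convex_position_enumeration:
  assumes fin: "finite V" and gp: "general_position V" and cp: "convex_position V" and v: "v \<in> V"
  obtains p where "ccw_polygon p (card V)" "p ` {..<card V} = V" "p 0 = v"
proof -
  have nz: "orient a b c \<noteq> 0" if "a \<in> V" "b \<in> V" "c \<in> V" "distinct [a, b, c]" for a b c
    using gp that orient_eq_0_collinear unfolding general_position_def by blast
  have nh: False if "a \<in> V" "convex hull S \<subseteq> convex hull (V - {a})" "a \<in> convex hull S" for a S
    using cp that unfolding convex_position_def by blast
  have notri: "\<not> (orient a y z > 0 \<and> orient a z x > 0 \<and> orient a x y > 0)"
    if "a \<in> V" "x \<in> V" "y \<in> V" "z \<in> V" for a x y z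
  proof
    assume h: "orient a y z > 0 \<and> orient a z x > 0 \<and> orient a x y > 0"
    then have "a \<noteq> x" "a \<noteq> y" "a \<noteq> z" by auto
    then have "convex hull {x, y, z} \<subseteq> convex hull (V - {a})"
      using that by (intro hull_mono) auto
    then show False using nh in_triangle h that(1) by blast
  qed
  \<comment> \<open>The point \<open>v\<close> is made the least element, which later gives
    \<open>p 0 = v\<close>.\<close>
  define R where "R x y \<longleftrightarrow> x \<noteq> y \<and> (x = v \<or> (y \<noteq> v \<and> orient v x y > 0))" for x y
  have tot: "R x y \<or> R y x" if "x \<in> V" "y \<in> V" "x \<noteq> y" for x y
    using nz[of v x y] that v orient_swap[of v x y] by (auto simp: R_def)
  have tr: "R x z" if V: "x \<in> V" "y \<in> V" "z \<in> V" and r: "R x y" "R y z" for x y z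
  proof (cases "x = v")
    case True
    then show ?thesis using r by (auto simp: R_def)
  next
    case False
    then have o: "orient v x y > 0" "orient v y z > 0" "y \<noteq> v" "z \<noteq> v"
      using r by (auto simp: R_def)
    have "x \<noteq> z" using o orient_swap[of v x y] by auto
    \<comment> \<open>Otherwise \<open>v\<close> would lie inside the triangle
      \<open>x y z\<close>.\<close>
    moreover have "\<not> orient v z x > 0" using notri[of v x y z] v V o by auto
    ultimately show ?thesis
      using nz[of v x z] V v False o orient_swap[of v x z] by (auto simp: R_def)
  qed
  obtain p where p: "bij_betw p {..<card V} V"
    and pR: "\<And>i j. i < j \<Longrightarrow> j < card V \<Longrightarrow> R (p i) (p j)"
  proof -
    have "\<exists>p. bij_betw p {..<card V} V \<and> (\<forall>i j. i < j \<longrightarrow> j < card V \<longrightarrow> R (p i) (p j))"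
      by (rule finite_strict_order_enumeration[OF fin]) (fact tr, fact tot)
    then show thesis using that by blast
  qed
  have im: "p ` {..<card V} = V" and inj: "inj_on p {..<card V}"
    using p by (auto simp: bij_betw_def)
  have mem: "p i \<in> V" if "i < card V" for i using im that by auto
  have "p 0 = v"
  proof -
    obtain i where i: "i < card V" "p i = v" using v im by (metis imageE lessThan_iff)
    then show ?thesis using pR[of 0 i] by (cases "i = 0") (auto simp: R_def)
  qed
  moreover have "0 < orient (p i) (p j) (p k)" if "i < j" "j < k" "k < card V" for i j k
  proof (cases "p i = v")
    case True
    then show ?thesis using pR[of i j] pR[of i k] pR[of j k] that by (auto simp: R_def)
  next
    case False
    have r: "R (p i) (p j)" "R (p j) (p k)" "R (p i) (p k)" using pR that by auto
    then have o: "orient v (p i) (p j) > 0" "orient v (p j) (p k) > 0" "orient v (p i) (p k) > 0"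
      and d: "p i \<noteq> p j" "p j \<noteq> p k" "p i \<noteq> p k" "p j \<noteq> v" "p k \<noteq> v"
      using False by (auto simp: R_def)
    have V: "p i \<in> V" "p j \<in> V" "p k \<in> V" using mem that by auto
    \<comment> \<open>A clockwise turn here would put \<open>p j\<close> into the triangle formed by
      \<open>p i\<close>, \<open>p k\<close> and \<open>v\<close>.\<close>
    have "\<not> orient (p i) (p j) (p k) < 0"
      using notri[of "p j" "p i" "p k" v] V v o
        orient_rotate[of "p j" "p k" v] orient_rotate[of v "p i" "p j"]
        orient_swap[of "p j" "p i" "p k"] orient_rotate[of "p i" "p j" "p k"]
        orient_rotate[of "p j" v "p i"] orient_rotate[of "p j" "p k" "p i"]
        orient_rotate[of "p k" v "p j"]
      by (smt (verit, ccfv_threshold) orient_rotate orient_swap)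
    then show ?thesis using nz[of "p i" "p j" "p k"] V d by force
  qed
  ultimately show ?thesis
    using that[of p] inj im unfolding ccw_polygon_def by blast
qed


subsection \<open>Double stars\<close>

lemma complete_edges_iff: "{a, b} \<in> complete_edges V \<longleftrightarrow> a \<in> V \<and> b \<in> V \<and> a \<noteq> b"
proof
  assume "{a, b} \<in> complete_edges V"
  then obtain c d where "{a, b} = {c, d}" "c \<in> V" "d \<in> V" "c \<noteq> d"
    unfolding complete_edges_def by blast
  then show "a \<in> V \<and> b \<in> V \<and> a \<noteq> b" by (auto simp: doubleton_eq_iff)
qed (auto simp only: complete_edges_def)

lemma walk_singleton [simp]: "walk E [x]"
  by (simp add: walk_def)

lemma walk_Cons_Cons [simp]: "walk E (x # y # xs) \<longleftrightarrow> {x, y} \<in> E \<and> walk E (y # xs)"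
proof -
  have "(\<forall>i. Suc i < length (x # y # xs) \<longrightarrow> {(x # y # xs) ! i, (x # y # xs) ! Suc i} \<in> E) \<longleftrightarrow>
      {x, y} \<in> E \<and> (\<forall>i. Suc i < length (y # xs) \<longrightarrow> {(y # xs) ! i, (y # xs) ! Suc i} \<in> E)"
    (is "?L \<longleftrightarrow> ?R")
  proof
    assume L: ?L
    have "{(x # y # xs) ! 0, (x # y # xs) ! Suc 0} \<in> E" 
      by (rule L[rule_format]) simp
    moreover have "{(y # xs) ! i, (y # xs) ! Suc i} \<in> E" if "Suc i < length (y # xs)" for i
      using L[rule_format, of "Suc i"] that by simp
    ultimately show ?R by simp
  next
    assume R: ?R
    show ?L
    proof (intro allI impI)
      fix i assume i: "Suc i < length (x # y # xs)"
      show "{(x # y # xs) ! i, (x # y # xs) ! Suc i} \<in> E"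
        using R i by (cases i) simp_all
    qed
  qed
  then show ?thesis by (simp add: walk_def)
qed

lemma seg_cross_commute: "seg_cross e f \<longleftrightarrow> seg_cross f e"
  unfolding seg_cross_def by (metis Int_commute)

lemma not_seg_cross_common: "x \<in> e \<Longrightarrow> x \<in> f \<Longrightarrow> \<not> seg_cross e f"
  unfolding seg_cross_def by blast

text \<open>Every vertex of a cycle has two different neighbours, and among its first three vertices
  at most two lie in \<open>{a, b}\<close>. This refutes cycles in double stars, where only the two
  centres can have several neighbours.\<close>

lemma has_cycle_two_neighbours:
  assumes "has_cycle E"
  obtains x q r where "x \<notin> {a, b}" "q \<noteq> r" "{x, q} \<in> E" "{x, r} \<in> E"
proof -
  obtain xs where xs: "length xs \<ge> 3" "distinct xs" "walk E xs" "{last xs, hd xs} \<in> E"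
    using assms unfolding has_cycle_def by auto
  have ne: "xs \<noteq> []" using xs by auto
  have step: "{xs ! i, xs ! Suc i} \<in> E" if "Suc i < length xs" for i
    using xs(3) that by (simp add: walk_def)
  have nb: "\<exists>q r. q \<noteq> r \<and> {xs ! t, q} \<in> E \<and> {xs ! t, r} \<in> E" if t: "t < 3" for t
  proof -
    define q where "q = (if t = 0 then last xs else xs ! (t - 1))"
    define r where "r = (if Suc t = length xs then hd xs else xs ! Suc t)"
    have "{xs ! t, q} \<in> E"
      using step[of "t - 1"] xs t ne
      by (cases "t = 0") (auto simp: q_def insert_commute hd_conv_nth)
    moreover have "{xs ! t, r} \<in> E"
      using step[of t] xs t ne
      by (cases "Suc t = length xs") (auto simp: r_def last_conv_nth hd_conv_nth dest: sym)
    moreover have "q \<noteq> r"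
      using xs t ne
      by (auto simp: q_def r_def last_conv_nth hd_conv_nth nth_eq_iff_index_eq split: if_splits)
    ultimately show ?thesis by blast
  qed
  have "xs ! 0 \<noteq> xs ! 1" "xs ! 0 \<noteq> xs ! 2" "xs ! 1 \<noteq> xs ! 2"
    using xs ne by (simp_all add: nth_eq_iff_index_eq)
  then have "xs ! 0 \<notin> {a, b} \<or> xs ! 1 \<notin> {a, b} \<or> xs ! 2 \<notin> {a, b}" by auto
  moreover have "(0::nat) < 3" "(1::nat) < 3" "(2::nat) < 3" by simp_all
  ultimately obtain t where "t < 3" "xs ! t \<notin> {a, b}" by blast
  then show thesis using nb[of t] that by blast
qed

text \<open>The central edge \<open>{a, b}\<close> belongs to the first set when \<open>b\<close>
  lies in \<open>V\<close> and differs from \<open>a\<close>, as long as \<open>b\<close> is kept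
  out of \<open>S\<close>. An empty \<open>S\<close> gives the star at \<open>a\<close>.\<close>

definition double_star :: "pt set \<Rightarrow> pt \<Rightarrow> pt \<Rightarrow> pt set \<Rightarrow> edge set" where
  "double_star V a b S = (\<lambda>x. {a, x}) ` (V - S - {a}) \<union> (\<lambda>z. {b, z}) ` S"

text \<open>Each vertex is a centre or adjacent to one, so walks through the central edge have at
  most four vertices. Edges at the same centre share an endpoint, which leaves only pairs at
  different centres to be checked for crossings.\<close>

lemma double_star_in_trees_le:
  assumes ab: "a \<in> V" "b \<in> V" "a \<noteq> b" and S: "S \<subseteq> V - {a, b}"
    and nc: "\<And>x z. \<lbrakk>x \<in> V - S - {a, b}; z \<in> S\<rbrakk> \<Longrightarrow> \<not> seg_cross {a, x} {b, z}"
  shows "double_star V a b S \<in> trees_le V 3"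
proof -
  let ?T = "double_star V a b S"
  have a: "{a, x} \<in> ?T" "{x, a} \<in> ?T" if "x \<in> V" "x \<notin> S" "x \<noteq> a" for x
    using that by (auto simp: double_star_def insert_commute)
  have b: "{b, z} \<in> ?T" "{z, b} \<in> ?T" if "z \<in> S" for z
    using that by (auto simp: double_star_def insert_commute)
  have "b \<notin> S" using S by blast
  then have "{a, b} \<in> ?T" "{b, a} \<in> ?T" using a[of b] ab by simp_all
  note T = a b this
  have diam: "\<exists>xs. walk ?T xs \<and> hd xs = u \<and> last xs = w \<and> length xs \<le> 3 + 1"
    if uw: "u \<in> V" "w \<in> V" for u w
  proof -
    have ex: ?thesis if "walk ?T xs" "hd xs = u" "last xs = w" "length xs \<le> 4" for xs
      using that by auto
    consider "u = w" | "u \<in> S" "w \<in> S" | "u \<in> S" "w = a" | "u \<in> S" "w \<notin> S" "w \<noteq> a"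
      | "u = a" "w \<in> S" | "u = a" "w \<notin> S" "w \<noteq> a" | "u \<notin> S" "u \<noteq> a" "w \<in> S"
      | "u \<notin> S" "u \<noteq> a" "w = a" | "u \<notin> S" "u \<noteq> a" "w \<notin> S" "w \<noteq> a" by blast
    then show ?thesis
    proof cases
      case 1 then show ?thesis by (intro ex[of "[u]"]) auto
    next
      case 2 then show ?thesis by (intro ex[of "[u, b, w]"]) (use T uw in auto)
    next
      case 3 then show ?thesis by (intro ex[of "[u, b, a]"]) (use T uw in auto)
    next
      case 4 then show ?thesis by (intro ex[of "[u, b, a, w]"]) (use T uw in auto)
    next
      case 5 then show ?thesis by (intro ex[of "[a, b, w]"]) (use T uw in auto)
    next
      case 6 then show ?thesis by (intro ex[of "[a, w]"]) (use T uw in auto)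
    next
      case 7 then show ?thesis by (intro ex[of "[u, a, b, w]"]) (use T uw in auto)
    next
      case 8 then show ?thesis by (intro ex[of "[u, a]"]) (use T uw in auto)
    next
      case 9 then show ?thesis by (intro ex[of "[u, a, w]"]) (use T uw in auto)
    qed
  qed
  have "\<not> has_cycle ?T"
  proof
    assume "has_cycle ?T"
    then obtain x q r where x: "x \<notin> {a, b}" "q \<noteq> r" "{x, q} \<in> ?T" "{x, r} \<in> ?T"
      by (rule has_cycle_two_neighbours)
    \<comment> \<open>A vertex other than the centres has a single neighbour, so it cannot lie on a
      cycle.\<close>
    have "q = (if x \<in> S then b else a)" if "{x, q} \<in> ?T" for q
      using x(1) that S by (auto simp: double_star_def doubleton_eq_iff)
    then show False using x by metis
  qed
  moreover have "?T \<subseteq> complete_edges V"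
    using ab S by (auto simp: double_star_def complete_edges_iff)
  moreover have "graph_connected V ?T"
    unfolding graph_connected_def using diam by blast
  moreover have "simple_geo ?T"
  proof -
    have "\<not> seg_cross {a, x} {b, z}" if "x \<in> V - S - {a}" "z \<in> S" for x z
      using that nc not_seg_cross_common[of b] by (cases "x = b") auto
    then have cross: "\<not> seg_cross e f" "\<not> seg_cross f e"
      if "e \<in> (\<lambda>x. {a, x}) ` (V - S - {a})" "f \<in> (\<lambda>z. {b, z}) ` S" for e f
      using that unfolding seg_cross_commute[of f e] by blast+
    have same: "\<not> seg_cross e f"
      if "e \<in> (\<lambda>x. {c, x}) ` A" "f \<in> (\<lambda>x. {c, x}) ` A" for e f c A
      using that by (intro not_seg_cross_common[of c]) auto
    show ?thesis
      unfolding simple_geo_def double_star_def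
      by (intro ballI, elim UnE) (rule same cross, assumption+)+
  qed
  ultimately show ?thesis
    using diam by (auto simp: trees_le_def spanning_tree_def diameter_le_def)
qed

section \<open>Chords and leaf arcs of a convex polygon\<close>

context ccw_polygon
begin

lemma p_eq_iff: "\<lbrakk>i < n; j < n\<rbrakk> \<Longrightarrow> p i = p j \<longleftrightarrow> i = j"
  by (rule inj_on_eq_iff[OF inj]) auto

text \<open>Sorting \<open>a\<close>, \<open>b\<close>, \<open>x\<close> gives an increasing triple;
  its counterclockwise turn determines the sign after a rotation or a swap.\<close>

lemma chord_side:
  assumes "a < b" "b < n" "x < n"
  shows "a < x \<Longrightarrow> x < b \<Longrightarrow> orient (p a) (p b) (p x) < 0"
    and "x < a \<or> b < x \<Longrightarrow> orient (p a) (p b) (p x) > 0"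
  using ccw[of a x b] ccw[of x a b] ccw[of a b x] assms
    orient_swap[of "p a" "p b" "p x"] orient_rotate[of "p a" "p b" "p x"]
  by auto

text \<open>If the ends of two disjoint chords do not interlace, \<open>b\<close> and
  \<open>z\<close> lie strictly on the same side of the other chord. Taking \<open>min\<close> and
  \<open>max\<close> allows either order of its ends.\<close>

lemma chords_not_cross:
  assumes ax: "a < n" "x < n" and bz: "b < n" "z < n" and ne: "{a, x} \<inter> {b, z} = {}" "a \<noteq> x"
    and side: "min a x < b \<and> b < max a x \<longleftrightarrow> min a x < z \<and> z < max a x"
  shows "\<not> seg_cross {p a, p x} {p b, p z}"
proof -
  define l where "l = min a x"
  define u where "u = max a x"
  have l: "l < u" "u < n" "{p a, p x} = {p l, p u}"
    using ax ne by (auto simp: l_def u_def min_def max_def)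
  have "b \<noteq> l" "b \<noteq> u" "z \<noteq> l" "z \<noteq> u" using ne by (auto simp: l_def u_def min_def max_def)
  moreover have "l < b \<and> b < u \<longleftrightarrow> l < z \<and> z < u" using side by (simp add: l_def u_def)
  ultimately have "orient (p l) (p u) (p b) * orient (p l) (p u) (p z) > 0"
    using chord_side[OF l(1,2) bz(1)] chord_side[OF l(1,2) bz(2)]
    by (metis linorder_neqE_nat mult_neg_neg mult_pos_pos)
  then show ?thesis unfolding l(3) by (rule not_seg_cross_same_side)
qed

lemma chords_not_line_cross:
  assumes ax: "a < n" "x < n" and bz: "b < n" "z < n" and ne: "a \<noteq> x"
    and side: "{b, z} \<subseteq> {min a x..max a x} \<or> {b, z} \<inter> {min a x<..<max a x} = {}"
  shows "\<not> line_crosses {p a, p x} {p b, p z}"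
proof -
  define l where "l = min a x"
  define u where "u = max a x"
  have l: "l < u" "u < n" "{p a, p x} = {p l, p u}"
    using ax ne by (auto simp: l_def u_def min_def max_def)
  \<comment> \<open>Vertices with indices between \<open>l\<close> and \<open>u\<close> have
    negative orientation, hence the factor -1 when both \<open>b\<close> and \<open>z\<close> lie in
    that range.\<close>
  define s :: real where "s = (if {b, z} \<subseteq> {l..u} then -1 else 1)"
  have sg: "0 \<le> s * orient (p l) (p u) (p c)" "orient (p l) (p u) (p c) = 0 \<Longrightarrow> p c \<in> {p l, p u}"
    if c: "c \<in> {b, z}" for c
  proof -
    have "c < n" using c bz by auto
    note cs = chord_side[OF l(1,2) this]
    show "orient (p l) (p u) (p c) = 0 \<Longrightarrow> p c \<in> {p l, p u}"
      using cs by (metis insertI1 insertI2 less_irrefl linorder_neqE_nat)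
    have side': "{b, z} \<subseteq> {l..u} \<or> {b, z} \<inter> {l<..<u} = {}"
      using side by (simp add: l_def u_def)
    show "0 \<le> s * orient (p l) (p u) (p c)"
    proof (cases "{b, z} \<subseteq> {l..u}")
      case True
      then have "c = l \<or> c = u \<or> l < c \<and> c < u" using c by auto
      then show ?thesis using cs True by (auto simp: s_def)
    next
      case False
      then have "\<not> (l < c \<and> c < u)" using c side' by auto
      then have "c = l \<or> c = u \<or> c < l \<or> u < c" by auto
      then show ?thesis using cs False by (auto simp: s_def)
    qed
  qed
  show ?thesis
    unfolding l(3)
    by (rule not_line_crosses_weak_side[of s]) (use sg in \<open>auto simp: s_def\<close>)
qed

text \<open>
  The last hypothesis says that the double star attaching \<open>S\<close> to \<open>y\<close> and everything else to the
  leaf \<open>i\<close> is crossing-free; its edges at \<open>i\<close> avoid \<open>B\<close> because the only neighbour \<open>s\<close> lies in \<open>S\<close>.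
\<close>

lemma leaf_arc_neighbour:
  assumes blk: "blocks (trees_le (p ` {..<n}) 3) B"
    and s: "s < n" and leaf: "\<And>x. \<lbrakk>x < n; {p i, p x} \<in> B\<rbrakk> \<Longrightarrow> x = s"
    and y: "i < n" "y < n" "i \<noteq> y" and S: "S \<subseteq> {..<n} - {i, y}" "s \<in> S"
    and nc: "\<And>x z. \<lbrakk>x < n; x \<notin> S; x \<noteq> i; x \<noteq> y; z \<in> S\<rbrakk> \<Longrightarrow>
       min i x < y \<and> y < max i x \<longleftrightarrow> min i x < z \<and> z < max i x"
  shows "\<exists>z\<in>S. {p y, p z} \<in> B"
proof -
  let ?V = "p ` {..<n}"
  have Sn: "z < n" "z \<noteq> i" "z \<noteq> y" if "z \<in> S" for z using S that by auto
  have "double_star ?V (p i) (p y) (p ` S) \<in> trees_le ?V 3"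
  proof (rule double_star_in_trees_le)
    show "p i \<in> ?V" "p y \<in> ?V" "p i \<noteq> p y" using y by (simp_all add: p_eq_iff)
    show "p ` S \<subseteq> ?V - {p i, p y}"
    proof (rule image_subsetI)
      fix z assume "z \<in> S"
      from Sn[OF this] show "p z \<in> ?V - {p i, p y}" using y by (simp add: p_eq_iff)
    qed
    fix a b assume a: "a \<in> ?V - p ` S - {p i, p y}" and b: "b \<in> p ` S"
    obtain x where x: "a = p x" "x < n" "x \<notin> S" "x \<noteq> i" "x \<noteq> y"
    proof -
      obtain x where "a = p x" "x < n" using a by blast
      then show thesis using a that[of x] by blast
    qed
    obtain z where z: "b = p z" "z \<in> S" using b by blast
    have "z \<noteq> x" using x(3) z(2) by blast
    have "\<not> seg_cross {p i, p x} {p y, p z}"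
      by (rule chords_not_cross[OF y(1) x(2) y(2) Sn(1)[OF z(2)] _ _ nc[OF x(2-5) z(2)]])
        (use x Sn[OF z(2)] y \<open>z \<noteq> x\<close> in simp_all)
    then show "\<not> seg_cross {p i, a} {p y, b}" unfolding x(1) z(1) .
  qed
  then have "B \<inter> double_star ?V (p i) (p y) (p ` S) \<noteq> {}"
    using blk unfolding blocks_def by blast
  then consider x where "x < n" "x \<notin> S" "{p i, p x} \<in> B" | z where "z \<in> S" "{p y, p z} \<in> B"
    unfolding double_star_def by blast
  then show ?thesis
  proof cases
    case 1
    then show ?thesis using leaf[of x] S by blast
  qed blast
qed

text \<open>For these four orders of \<open>i\<close>, \<open>s\<close> and \<open>y\<close> the arc
  from \<open>s\<close> to \<open>y\<close> avoiding the leaf \<open>i\<close> does not wrap around,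
  so \<open>S\<close> is an interval of indices that contains \<open>s\<close> but not
  \<open>y\<close>.\<close>

lemma leaf_arc_neighbours:
  assumes blk: "blocks (trees_le (p ` {..<n}) 3) B"
    and i: "i < n" "s < n" and leaf: "\<And>x. \<lbrakk>x < n; {p i, p x} \<in> B\<rbrakk> \<Longrightarrow> x = s"
  shows "\<lbrakk>s < y; y < i\<rbrakk> \<Longrightarrow> \<exists>q. s \<le> q \<and> q < y \<and> {p y, p q} \<in> B"
    and "\<lbrakk>s < i; y < s\<rbrakk> \<Longrightarrow> \<exists>q. y < q \<and> q \<le> s \<and> {p y, p q} \<in> B"
    and "\<lbrakk>i < y; y < s\<rbrakk> \<Longrightarrow> \<exists>q. y < q \<and> q \<le> s \<and> {p y, p q} \<in> B"
    and "\<lbrakk>i < s; s < y; y < n\<rbrakk> \<Longrightarrow> \<exists>q. s \<le> q \<and> q < y \<and> {p y, p q} \<in> B"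
proof -
  note arc = leaf_arc_neighbour[OF blk i(2) leaf i(1)]
  show "\<exists>q. s \<le> q \<and> q < y \<and> {p y, p q} \<in> B" if "s < y" "y < i"
  proof -
    have "\<exists>z\<in>{s..<y}. {p y, p z} \<in> B"
      by (rule arc) (use that i in \<open>auto simp: min_def max_def\<close>)
    then show ?thesis by auto
  qed
  show "\<exists>q. y < q \<and> q \<le> s \<and> {p y, p q} \<in> B" if "s < i" "y < s"
  proof -
    have "\<exists>z\<in>{y<..s}. {p y, p z} \<in> B"
      by (rule arc) (use that i in \<open>auto simp: min_def max_def\<close>)
    then show ?thesis by auto
  qed
  show "\<exists>q. y < q \<and> q \<le> s \<and> {p y, p q} \<in> B" if "i < y" "y < s"
  proof -
    have "\<exists>z\<in>{y<..s}. {p y, p z} \<in> B"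
      by (rule arc) (use that i in \<open>auto simp: min_def max_def\<close>)
    then show ?thesis by auto
  qed
  show "\<exists>q. s \<le> q \<and> q < y \<and> {p y, p q} \<in> B" if "i < s" "s < y" "y < n"
  proof -
    have "\<exists>z\<in>{s..<y}. {p y, p z} \<in> B"
      by (rule arc) (use that i in \<open>auto simp: min_def max_def\<close>)
    then show ?thesis by auto
  qed
qed

end

section \<open>Vertex degrees in a blocker\<close>

text \<open>The star at \<open>a\<close> is the double star with empty \<open>S\<close>, and
  \<open>B\<close> has to meet it.\<close>

lemma blocks_trees_le_no_isolated_vertex:
  assumes "blocks (trees_le V 3) B" "a \<in> V" "b \<in> V" "a \<noteq> b"
  shows "\<exists>x\<in>V - {a}. {a, x} \<in> B"
proof -
  have "double_star V a b {} \<in> trees_le V 3"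
    by (rule double_star_in_trees_le) (use assms in auto)
  then have "B \<inter> double_star V a b {} \<noteq> {}"
    using assms(1) unfolding blocks_def by blast
  then show ?thesis unfolding double_star_def by auto
qed

text \<open>Double counting of incidences: the degrees sum to \<open>2 * card B\<close>, which is
  less than \<open>2 * card V\<close>, so some vertex has degree below two; by \<open>nb\<close> its
  degree is exactly one.\<close>

lemma exists_leaf:
  assumes fin: "finite V" and B: "B \<subseteq> complete_edges V" and card: "card B < card V"
    and nb: "\<And>a. a \<in> V \<Longrightarrow> \<exists>e\<in>B. a \<in> e"
  obtains v u where "v \<in> V" "u \<in> V" "u \<noteq> v" "{v, u} \<in> B" "\<And>x. {v, x} \<in> B \<Longrightarrow> x = u"
proof -
  have "B \<subseteq> Pow V" using B unfolding complete_edges_def by blast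
  then have finB: "finite B" using fin finite_subset by blast
  have "\<exists>v\<in>V. card {e \<in> B. v \<in> e} < 2"
  proof (rule ccontr)
    assume "\<not> ?thesis"
    then have ge: "2 \<le> card {e \<in> B. v \<in> e}" if "v \<in> V" for v using that by force
    have "(\<Sum>v\<in>V. 2) \<le> (\<Sum>v\<in>V. card {e \<in> B. v \<in> e})"
      by (rule sum_mono) (rule ge)
    also have "\<dots> = 2 * card B"
    proof (rule sum_multicount[OF fin finB], rule ballI)
      fix e assume "e \<in> B"
      then obtain a b where "e = {a, b}" "a \<in> V" "b \<in> V" "a \<noteq> b"
        using B unfolding complete_edges_def by blast
      moreover from this have "{i \<in> V. i \<in> e} = {a, b}" by auto
      ultimately show "card {i \<in> V. i \<in> e} = 2" by simp
    qed
    finally show False using card by simp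
  qed
  then obtain v where v: "v \<in> V" "card {e \<in> B. v \<in> e} < 2" by auto
  obtain e where e: "e \<in> B" "v \<in> e" using nb v by blast
  obtain a b where ab: "e = {a, b}" "a \<in> V" "b \<in> V" "a \<noteq> b"
    using e B unfolding complete_edges_def by blast
  obtain u where u: "e = {v, u}" "u \<in> V" "u \<noteq> v"
    using ab e(2) that[of a] that[of b] by (auto simp: insert_commute)
  have "x = u" if "{v, x} \<in> B" for x
  proof (rule ccontr)
    assume "x \<noteq> u"
    then have "card {{v, x}, {v, u}} = 2" by (auto simp: card_2_iff doubleton_eq_iff)
    moreover have "card {{v, x}, {v, u}} \<le> card {e \<in> B. v \<in> e}"
      by (rule card_mono) (use finB that e u in auto)
    ultimately show False using v by simp
  qed
  then show thesis using that v u e by blast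
qed

subsection \<open>Structure of the parent function\<close>

text \<open>
  Here \<open>g\<close> is the parent function on one side of the root \<open>0\<close>; a vertex outside the range of \<open>g\<close>
  is a leaf. For the outermost vertex \<open>i\<close>, \<open>leaf_below\<close> turns \<open>0, ..., g i\<close> into a path, and
  downward induction applies this to every vertex beyond the maximal initial path.
\<close>

lemma path_and_leaves:
  fixes g :: "nat \<Rightarrow> nat"
  assumes lt: "\<And>i. \<lbrakk>1 \<le> i; i \<le> r\<rbrakk> \<Longrightarrow> g i < i"
    and leaf_above: "\<And>i y. \<lbrakk>1 \<le> i; i \<le> r; \<And>j. \<lbrakk>1 \<le> j; j \<le> r\<rbrakk> \<Longrightarrow> g j \<noteq> i; g i < y; y < i\<rbrakk> \<Longrightarrow> g i \<le> g y"
    and leaf_below: "\<And>i x. \<lbrakk>1 \<le> i; i \<le> r; \<And>j. \<lbrakk>1 \<le> j; j \<le> r\<rbrakk> \<Longrightarrow> g j \<noteq> i; x < g i\<rbrakk> \<Longrightarrow> \<exists>y. x < y \<and> y \<le> g i \<and> g y = x"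
  obtains m where "m \<le> r" "1 \<le> r \<Longrightarrow> 1 \<le> m"
    "\<And>i. \<lbrakk>1 \<le> i; i \<le> m\<rbrakk> \<Longrightarrow> g i = i - 1"
    "\<And>i. \<lbrakk>m < i; i \<le> r\<rbrakk> \<Longrightarrow> g i < m"
    "\<And>i j. \<lbrakk>m < i; i < j; j \<le> r\<rbrakk> \<Longrightarrow> g j \<le> g i"
proof -
  define P where "P m \<longleftrightarrow> m \<le> r \<and> (\<forall>i. 1 \<le> i \<and> i \<le> m \<longrightarrow> g i = i - 1)" for m
  define m where "m = Greatest P"
  have "P 0" by (auto simp: P_def)
  then have Pm: "P m" unfolding m_def by (rule GreatestI_nat[of _ _ r]) (simp add: P_def)
  have max: "k \<le> m" if "P k" for k
    unfolding m_def by (rule Greatest_le_nat[where P = P and b = r]) (use that in \<open>auto simp: P_def\<close>)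
  have path: "g i = i - 1" if "1 \<le> i" "i \<le> m" for i using Pm that by (auto simp: P_def)
  have mr: "m \<le> r" using Pm by (simp add: P_def)
  \<comment> \<open>Otherwise the initial path could be extended, against the maximality of
    \<open>m\<close>.\<close>
  have stop: "g (Suc m) \<noteq> m" if "m < r"
  proof
    assume "g (Suc m) = m"
    then have "P (Suc m)" using that path by (auto simp: P_def le_Suc_eq)
    then show False using max by fastforce
  qed
  have key: "g i < m \<and> (\<forall>y. m < y \<and> y < i \<longrightarrow> g i \<le> g y)" if "m < i" "i \<le> r" for i
    using that
  proof (induction "r - i" arbitrary: i rule: less_induct)
    case less
    have i: "1 \<le> i" using less.prems by simp
    \<comment> \<open>A vertex on the path has a parent below \<open>m\<close>, and so does every
      vertex beyond \<open>i\<close> by the induction hypothesis; all others have parents smaller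
      than \<open>i\<close> by \<open>lt\<close>.\<close>
    have leaf: "g j \<noteq> i" if j: "1 \<le> j" "j \<le> r" for j
    proof
      assume eq: "g j = i"
      show False
      proof (cases "j \<le> m")
        case True
        then show False using path[of j] j eq less.prems by simp
      next
        case False
        have "i < j" using lt[of j] j eq by simp
        then have "g j < m" using less.hyps[of j] j less.prems by simp
        then show False using eq less.prems by simp
      qed
    qed
    note below = leaf_below[OF i less.prems(2) leaf] and above = leaf_above[OF i less.prems(2) leaf]
    \<comment> \<open>Descent from \<open>g i\<close>: some \<open>y\<close> has parent
      \<open>g i - d - 1\<close>. If \<open>y\<close> exceeded \<open>g i - d\<close>, its parent
      would already be known to be \<open>y - 1\<close>, which is too large.\<close>
    have down: "g (g i - d) = g i - d - 1" if "d < g i" for d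
      using that
    proof (induction d rule: less_induct)
      case (less d)
      obtain y where y: "g i - d - 1 < y" "y \<le> g i" "g y = g i - d - 1"
        using below[of "g i - d - 1"] less.prems by auto
      have "y = g i - d"
      proof (rule ccontr)
        assume "y \<noteq> g i - d"
        then have "g i - y < d" "g i - (g i - y) = y" using y less.prems by linarith+
        then have "g y = y - 1" using less.IH[of "g i - y"] less.prems by simp
        then show False using y \<open>y \<noteq> g i - d\<close> less.prems by linarith
      qed
      then show ?case using y by simp
    qed
    have ne: "g (Suc m) \<noteq> m" using stop less.prems by simp
    have "\<not> m \<le> g i"
    proof
      assume "m \<le> g i"
      \<comment> \<open>In the first case the descent gives \<open>g (Suc m) = m\<close>; in the
        third, \<open>leaf_above\<close> and \<open>lt\<close> squeeze \<open>g (Suc m)\<close> to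
        \<open>m\<close>. All cases contradict \<open>stop\<close>.\<close>
      then consider "m < g i" | "g i = m" "i = Suc m" | "g i = m" "Suc m < i"
        using less.prems by linarith
      then show False
      proof cases
        case 1
        then show False using down[of "g i - Suc m"] ne by simp
      next
        case 3
        then show False using above[of "Suc m"] lt[of "Suc m"] ne less.prems by simp
      qed (use ne in auto)
    qed
    then show ?case using above by auto
  qed
  have "1 \<le> m" if "1 \<le> r"
    by (rule max) (use that lt[of 1] in \<open>auto simp: P_def le_Suc_eq\<close>)
  then show thesis
  proof (rule that[OF mr])
    show "g i = i - 1" if "1 \<le> i" "i \<le> m" for i by (rule path[OF that])
    show "g i < m" if "m < i" "i \<le> r" for i using key[OF that] by blast
    show "g j \<le> g i" if "m < i" "i < j" "j \<le> r" for i j using key[of j] that by simp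
  qed
qed

lemma path_edges_map_upt:
  "path_edges (map p [lo..<Suc hi]) = (\<lambda>i. {p i, p (Suc i)}) ` {lo..<hi}"
proof (intro equalityI subsetI)
  fix e assume "e \<in> path_edges (map p [lo..<Suc hi])"
  then obtain i where i: "Suc i < Suc hi - lo"
    "e = {map p [lo..<Suc hi] ! i, map p [lo..<Suc hi] ! Suc i}"
    by (auto simp: path_edges_def simp del: upt_Suc)
  then have "e = {p (lo + i), p (Suc (lo + i))}" by (simp del: upt_Suc)
  then show "e \<in> (\<lambda>i. {p i, p (Suc i)}) ` {lo..<hi}" using i by auto
next
  fix e assume "e \<in> (\<lambda>i. {p i, p (Suc i)}) ` {lo..<hi}"
  then obtain i where "i \<in> {lo..<hi}" "e = {p i, p (Suc i)}" by auto
  then show "e \<in> path_edges (map p [lo..<Suc hi])"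
    unfolding path_edges_def by (auto intro!: exI[of _ "i - lo"] simp del: upt_Suc simp: Suc_diff_le)
qed

lemma interior_vertices_map_upt:
  "interior_vertices (map p [lo..<Suc hi]) = p ` {lo<..<hi}"
proof (intro equalityI subsetI)
  fix v assume "v \<in> interior_vertices (map p [lo..<Suc hi])"
  then obtain i where i: "0 < i" "Suc i < Suc hi - lo" "v = map p [lo..<Suc hi] ! i"
    by (auto simp: interior_vertices_def simp del: upt_Suc)
  then have "v = p (lo + i)" by (simp del: upt_Suc)
  then show "v \<in> p ` {lo<..<hi}" using i by auto
next
  fix v assume "v \<in> p ` {lo<..<hi}"
  then obtain i where "i \<in> {lo<..<hi}" "v = p i" by auto
  then show "v \<in> interior_vertices (map p [lo..<Suc hi])"
    unfolding interior_vertices_def by (auto intro!: exI[of _ "i - lo"] simp del: upt_Suc)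
qed

subsection \<open>Boundary edges of a convex polygon\<close>

text \<open>The line through \<open>a\<close> and \<open>b\<close> bounds a half-plane containing
  \<open>V\<close>, so no point on it is interior to the hull.\<close>

lemma segment_in_frontier:
  assumes V: "a \<in> V" "b \<in> V" "a \<noteq> b" and s: "s \<noteq> 0"
    and side: "\<And>x. x \<in> V \<Longrightarrow> 0 \<le> s * orient a b x"
  shows "closed_segment a b \<subseteq> frontier (convex hull V)"
proof
  fix z assume z: "z \<in> closed_segment a b"
  \<comment> \<open>A normal of the line, scaled so that \<open>s * orient a b x\<close> is the
    slack in \<open>w \<bullet> x \<le> w \<bullet> a\<close>.\<close>
  define w where "w = (- s) *\<^sub>R (- (snd b - snd a), fst b - fst a)"
  have w: "w \<bullet> x = w \<bullet> a - s * orient a b x" for x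
    by (simp add: w_def orient_def inner_prod_def algebra_simps)
  have "w \<noteq> 0" using s V by (auto simp: w_def prod_eq_iff)
  obtain u where "z = (1 - u) *\<^sub>R a + u *\<^sub>R b" using z by (auto simp: in_segment)
  then have "orient a b z = 0" by (simp add: orient_affine)
  then have wz: "w \<bullet> z = w \<bullet> a" using w[of z] by simp
  have "w \<bullet> x \<le> w \<bullet> a" if "x \<in> V" for x
    using side[OF that] w[of x] by linarith
  then have "convex hull V \<subseteq> {x. w \<bullet> x \<le> w \<bullet> a}"
    by (intro hull_minimal convex_halfspace_le subsetI CollectI)
  then have "interior (convex hull V) \<subseteq> {x. w \<bullet> x < w \<bullet> a}"
    using interior_mono interior_halfspace_le[OF \<open>w \<noteq> 0\<close>] by metis
  then have "z \<notin> interior (convex hull V)" using wz by auto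
  moreover have "closed_segment a b \<subseteq> convex hull V"
    unfolding segment_convex_hull by (rule hull_mono) (use V in auto)
  then have "z \<in> closure (convex hull V)" using z closure_subset by blast
  ultimately show "z \<in> frontier (convex hull V)" by (simp add: frontier_def)
qed

text \<open>If the midpoint were on the frontier, a nonzero functional would attain its minimum over
  the hull there. It would then be equal at \<open>a\<close> and \<open>b\<close>, hence
  proportional to \<open>orient a b\<close>, whose signs at \<open>c\<close> and \<open>d\<close>
  are opposite.\<close>

lemma segment_not_in_frontier:
  assumes V: "a \<in> V" "b \<in> V" "c \<in> V" "d \<in> V"
    and c: "orient a b c < 0" and d: "orient a b d > 0"
  shows "\<not> closed_segment a b \<subseteq> frontier (convex hull V)"
proof
  define m where "m = (1/2) *\<^sub>R a + (1/2) *\<^sub>R b"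
  assume "closed_segment a b \<subseteq> frontier (convex hull V)"
  moreover have "m \<in> closed_segment a b"
    by (auto simp: in_segment m_def intro!: exI[of _ "1/2"])
  ultimately have m: "m \<in> closure (convex hull V)" "m \<notin> interior (convex hull V)"
    by (auto simp: frontier_def)
  obtain w where w: "w \<noteq> 0" "\<And>y. y \<in> closure (convex hull V) \<Longrightarrow> w \<bullet> m \<le> w \<bullet> y"
  \<comment> \<open>A hull with empty interior lies in a line, on which a normal functional is
    constant; otherwise a supporting line at \<open>m\<close> is used.\<close>
  proof (cases "interior (convex hull V) = {}")
    case True
    obtain w k where "w \<noteq> 0" and wk: "convex hull V \<subseteq> {x. w \<bullet> x = k}"
      using empty_interior_subset_hyperplane[OF convex_convex_hull True] by metis
    have "closure (convex hull V) \<subseteq> {x. w \<bullet> x = k}"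
      by (rule closure_minimal[OF wk closed_hyperplane])
    then have "w \<bullet> m \<le> w \<bullet> y" if "y \<in> closure (convex hull V)" for y
    proof -
      have "w \<bullet> y = k" "w \<bullet> m = k" using that m(1) \<open>closure _ \<subseteq> _\<close> by blast+
      then show ?thesis by simp
    qed
    then show thesis by (rule that[OF \<open>w \<noteq> 0\<close>])
  next
    case False
    then have "m \<notin> rel_interior (convex hull V)"
      using m(2) by (simp add: rel_interior_nonempty_interior)
    then show thesis
      using supporting_hyperplane_relative_frontier[OF convex_convex_hull m(1)] that by metis
  qed
  have wV: "w \<bullet> m \<le> w \<bullet> y" if "y \<in> V" for y
    using w(2) that by (meson closure_subset hull_inc subsetD)
  have "w \<bullet> m = (w \<bullet> a + w \<bullet> b) / 2" by (simp add: m_def inner_add_right)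
  then have eq: "w \<bullet> a = w \<bullet> m" "w \<bullet> b = w \<bullet> m" using wV[of a] wV[of b] V by auto
  define e1 e2 where "e1 = fst b - fst a" and "e2 = snd b - snd a"
  define t where "t = snd w * e1 - fst w * e2"
  have perp: "fst w * e1 + snd w * e2 = 0"
    using eq by (simp add: inner_prod_def e1_def e2_def algebra_simps)
  \<comment> \<open>As \<open>w\<close> is orthogonal to \<open>b - a\<close>, the functional is a
    multiple of \<open>orient a b\<close> up to the squared length of \<open>b - a\<close>;
    \<open>t\<close> is the cross product of \<open>b - a\<close> and \<open>w\<close>.\<close>
  have id: "(w \<bullet> y - w \<bullet> m) * (e1\<^sup>2 + e2\<^sup>2) = t * orient a b y" for y
  proof -
    have "w \<bullet> y - w \<bullet> m = fst w * (fst y - fst a) + snd w * (snd y - snd a)"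
      unfolding eq(1)[symmetric] by (simp add: inner_prod_def algebra_simps)
    moreover have "(fst w * y1 + snd w * y2) * (e1\<^sup>2 + e2\<^sup>2) - t * (e1 * y2 - e2 * y1)
        = (fst w * e1 + snd w * e2) * (e1 * y1 + e2 * y2)" for y1 y2
      by (simp add: t_def algebra_simps power2_eq_square)
    ultimately show ?thesis
      using perp by (simp add: orient_def e1_def e2_def)
  qed
  have "0 \<le> t * orient a b c" "0 \<le> t * orient a b d"
    using wV V id[symmetric] by simp_all
  then have "t = 0" using c d by (auto simp: zero_le_mult_iff)
  \<comment> \<open>Lagrange's identity: since the scalar and cross products both vanish,
    \<open>w\<close> or \<open>b - a\<close> is zero.\<close>
  moreover have "(fst w * e1 + snd w * e2)\<^sup>2 + t\<^sup>2 = ((fst w)\<^sup>2 + (snd w)\<^sup>2) * (e1\<^sup>2 + e2\<^sup>2)"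
    by (simp add: t_def algebra_simps power2_eq_square)
  ultimately have "(fst w)\<^sup>2 + (snd w)\<^sup>2 = 0 \<or> e1\<^sup>2 + e2\<^sup>2 = 0" using perp by simp
  then have "w = 0 \<or> e1 = 0 \<and> e2 = 0"
    by (auto simp: sum_power2_eq_zero_iff prod_eq_iff)
  then show False using w c by (auto simp: orient_def e1_def e2_def)
qed

context ccw_polygon
begin

lemma boundary_edge_iff:
  assumes ij: "i < j" "j < n"
  shows "{p i, p j} \<in> boundary_edges (p ` {..<n}) \<longleftrightarrow> j = Suc i \<or> i = 0 \<and> j = n - 1"
proof -
  let ?V = "p ` {..<n}"
  have "p i \<noteq> p j" using p_eq_iff ij by simp
  moreover from this have "{p i, p j} \<in> complete_edges ?V"
    using ij by (simp add: complete_edges_iff)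
  ultimately have *: "{p i, p j} \<in> boundary_edges ?V \<longleftrightarrow>
      closed_segment (p i) (p j) \<subseteq> frontier (convex hull ?V)"
  proof -
    have "(\<exists>a b. {c, d} = {a, b} \<and> closed_segment a b \<subseteq> F) \<longleftrightarrow> closed_segment c d \<subseteq> F"
      for c d :: pt and F
      unfolding segment_convex_hull
    proof
      assume "\<exists>a b. {c, d} = {a, b} \<and> convex hull {a, b} \<subseteq> F"
      then obtain a b where "{c, d} = {a, b}" "convex hull {a, b} \<subseteq> F" by blast
      then show "convex hull {c, d} \<subseteq> F" by simp
    qed blast
    then show ?thesis
      using \<open>{p i, p j} \<in> complete_edges ?V\<close> by (simp only: boundary_edges_def mem_Collect_eq simp_thms)
  qed
  note cs = chord_side[OF ij]
  show ?thesis
  proof (cases "j = Suc i \<or> i = 0 \<and> j = n - 1")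
    case True
    define s :: real where "s = (if j = Suc i then 1 else -1)"
    have "0 \<le> s * orient (p i) (p j) (p x)" if "x < n" for x
    proof -
      have "x = i \<or> x = j \<or> i < x \<and> x < j \<or> x < i \<or> j < x" by auto
      then show ?thesis using cs[OF that] True that by (auto simp: s_def)
    qed
    then have "closed_segment (p i) (p j) \<subseteq> frontier (convex hull ?V)"
      using ij \<open>p i \<noteq> p j\<close> by (intro segment_in_frontier[of _ _ _ s]) (auto simp: s_def)
    then show ?thesis using * True by simp
  next
    case False
    have c: "orient (p i) (p j) (p (Suc i)) < 0" using cs[of "Suc i"] ij False by simp
    \<comment> \<open>A vertex on the far side of the chord: index 0, or the last index when 0 is
      itself an end of the chord.\<close>
    define d where "d = (if i = 0 then n - 1 else 0)"
    have d: "d < n" "orient (p i) (p j) (p d) > 0" using cs[of d] ij False by (auto simp: d_def)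
    have "\<not> closed_segment (p i) (p j) \<subseteq> frontier (convex hull ?V)"
      by (rule segment_not_in_frontier[OF _ _ _ _ c d(2)]) (use ij d in auto)
    then show ?thesis using * False by simp
  qed
qed

end

section \<open>Comb structure of the tree of parents\<close>

text \<open>\<open>f i\<close> is the parent of \<open>i\<close> in the tree \<open>B\<close> rooted at \<open>k\<close>; the value \<open>f k\<close> is irrelevant.\<close>

locale blocked_polygon = ccw_polygon +
  fixes B :: "edge set" and k :: nat and f :: "nat \<Rightarrow> nat"
  assumes blocked: "blocks (trees_le (p ` {..<n}) 3) B"
    and root: "k < n"
    and right: "\<And>i. \<lbrakk>k < i; i < n\<rbrakk> \<Longrightarrow> k \<le> f i \<and> f i < i"
    and left: "\<And>i. i < k \<Longrightarrow> i < f i \<and> f i \<le> k"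
    and edges: "B = (\<lambda>i. {p i, p (f i)}) ` ({..<n} - {k})"
begin

lemma parent_less: "\<lbrakk>i < n; i \<noteq> k\<rbrakk> \<Longrightarrow> f i < n"
  using right[of i] left[of i] root by (cases "k < i") auto

lemma parent_neq: "\<lbrakk>i < n; i \<noteq> k\<rbrakk> \<Longrightarrow> f i \<noteq> i"
  using right[of i] left[of i] by (cases "k < i") auto

lemma edge_iff:
  assumes "i < n" "j < n"
  shows "{p i, p j} \<in> B \<longleftrightarrow> i \<noteq> k \<and> j = f i \<or> j \<noteq> k \<and> i = f j"
proof
  assume "{p i, p j} \<in> B"
  then obtain l where l: "l < n" "l \<noteq> k" "{p i, p j} = {p l, p (f l)}"
    unfolding edges by blast
  then have "i = l \<and> j = f l \<or> i = f l \<and> j = l"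
    using assms parent_less[OF l(1,2)] by (simp add: doubleton_eq_iff p_eq_iff)
  then show "i \<noteq> k \<and> j = f i \<or> j \<noteq> k \<and> i = f j" using l by auto
next
  have edge: "{p i, p (f i)} \<in> B" if "i < n" "i \<noteq> k" for i
    unfolding edges using that by blast
  assume "i \<noteq> k \<and> j = f i \<or> j \<noteq> k \<and> i = f j"
  then show "{p i, p j} \<in> B"
    using edge assms by (metis insert_commute)
qed

text \<open>Shifting the root to 0 reduces this side to \<open>path_and_leaves\<close>. The leaf
  hypotheses there come from the arcs of \<open>leaf_arc_neighbours\<close>, because a vertex that
  is no parent has only its own parent as neighbour.\<close>

lemma right_path:
  obtains hi where "k \<le> hi" "hi < n" "k < n - 1 \<Longrightarrow> k < hi"
    "\<And>i. \<lbrakk>k < i; i \<le> hi\<rbrakk> \<Longrightarrow> f i = i - 1"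
    "\<And>i. \<lbrakk>hi < i; i < n\<rbrakk> \<Longrightarrow> f i < hi"
    "\<And>i j. \<lbrakk>hi < i; i < j; j < n\<rbrakk> \<Longrightarrow> f j \<le> f i"
proof -
  define g where "g i = f (k + i) - k" for i
  define r where "r = n - 1 - k"
  have g: "f (k + i) = k + g i" "g i < i" if "1 \<le> i" "i \<le> r" for i
  proof -
    have "k < k + i" "k + i < n" using that root unfolding r_def by linarith+
    then show "f (k + i) = k + g i" "g i < i" using right[of "k + i"] unfolding g_def by linarith+
  qed
  have leaf: "x = k + g i"
    if i: "1 \<le> i" "i \<le> r" and nc: "\<And>j. \<lbrakk>1 \<le> j; j \<le> r\<rbrakk> \<Longrightarrow> g j \<noteq> i"
      and x: "x < n" "{p (k + i), p x} \<in> B" for i x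
  proof -
    have "k + i < n" using i root by (simp add: r_def)
    then consider "x = f (k + i)" | "x \<noteq> k" "k + i = f x" using x edge_iff by blast
    then show ?thesis
    proof cases
      case 1
      then show ?thesis using g(1)[OF i] by simp
    next
      case 2
      \<comment> \<open>Vertices left of the root have parents at most \<open>k\<close>, so a child
        of \<open>k + i\<close> must lie on the right.\<close>
      then have "k < x" using left[of x] i by (cases "x < k") auto
      then have "1 \<le> x - k" "x - k \<le> r" "k + (x - k) = x" using x by (auto simp: r_def)
      then show ?thesis using nc[of "x - k"] g(1)[of "x - k"] 2 by simp
    qed
  qed
  have above: "g i \<le> g y"
    if i: "1 \<le> i" "i \<le> r" and nc: "\<And>j. \<lbrakk>1 \<le> j; j \<le> r\<rbrakk> \<Longrightarrow> g j \<noteq> i"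
      and y: "g i < y" "y < i" for i y
  proof -
    have n: "k + i < n" "k + g i < n" "k + y < n" using i y root by (auto simp: r_def)
    obtain q where q: "k + g i \<le> q" "q < k + y" "{p (k + y), p q} \<in> B"
      using leaf_arc_neighbours(1)[OF blocked n(1,2) leaf[OF i nc], of "k + y"] y by auto
    \<comment> \<open>The neighbour found is nearer to the root, so it is the parent of
      \<open>k + y\<close>, not a child. In \<open>below\<close> the neighbour is farther away and
      hence a child.\<close>
    then consider "q = f (k + y)" | "q \<noteq> k" "k + y = f q" using edge_iff[OF n(3), of q] n by auto
    then show ?thesis
    proof cases
      case 1
      then show ?thesis using g(1)[of y] q i y by simp
    next
      case 2
      then show ?thesis using right[of q] q n by simp
    qed
  qed
  have below: "\<exists>y. x < y \<and> y \<le> g i \<and> g y = x"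
    if i: "1 \<le> i" "i \<le> r" and nc: "\<And>j. \<lbrakk>1 \<le> j; j \<le> r\<rbrakk> \<Longrightarrow> g j \<noteq> i"
      and x: "x < g i" for i x
  proof -
    have n: "k + i < n" "k + g i < n" "k + x < n" "k + g i < k + i"
      using i x g(2)[OF i] root by (auto simp: r_def)
    obtain q where q: "k + x < q" "q \<le> k + g i" "{p (k + x), p q} \<in> B"
      using leaf_arc_neighbours(2)[OF blocked n(1,2) leaf[OF i nc] n(4), of "k + x"] x by auto
    then consider "k + x \<noteq> k" "q = f (k + x)" | "q \<noteq> k" "k + x = f q"
      using edge_iff[OF n(3), of q] n by auto
    then show ?thesis
    proof cases
      case 1
      then show ?thesis using right[of "k + x"] q n by simp
    next
      case 2
      then show ?thesis using q by (intro exI[of _ "q - k"]) (auto simp: g_def)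
    qed
  qed
  obtain m where m: "m \<le> r" "1 \<le> r \<Longrightarrow> 1 \<le> m" "\<And>i. \<lbrakk>1 \<le> i; i \<le> m\<rbrakk> \<Longrightarrow> g i = i - 1"
    "\<And>i. \<lbrakk>m < i; i \<le> r\<rbrakk> \<Longrightarrow> g i < m" "\<And>i j. \<lbrakk>m < i; i < j; j \<le> r\<rbrakk> \<Longrightarrow> g j \<le> g i"
  proof (rule path_and_leaves[of r g])
    show "g i < i" if "1 \<le> i" "i \<le> r" for i by (rule g(2)[OF that])
    show "g i \<le> g y" if "1 \<le> i" "i \<le> r" "\<And>j. \<lbrakk>1 \<le> j; j \<le> r\<rbrakk> \<Longrightarrow> g j \<noteq> i" "g i < y" "y < i" for i y
      by (rule above[OF that])
    show "\<exists>y. x < y \<and> y \<le> g i \<and> g y = x"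
      if "1 \<le> i" "i \<le> r" "\<And>j. \<lbrakk>1 \<le> j; j \<le> r\<rbrakk> \<Longrightarrow> g j \<noteq> i" "x < g i" for i x
      by (rule below[OF that])
  qed (rule that)
  have fg: "f i = k + g (i - k)" "1 \<le> i - k" "i - k \<le> r" if "k < i" "i < n" for i
    using g(1)[of "i - k"] that by (auto simp: r_def)
  show thesis
  proof (rule that[of "k + m"])
    show "k + m < n" using m(1) root by (simp add: r_def)
    show "k < k + m" if "k < n - 1" using m(2) that unfolding r_def by linarith
    show "f i = i - 1" if "k < i" "i \<le> k + m" for i
      using fg[of i] m(3)[of "i - k"] that \<open>k + m < n\<close> by simp
    show "f i < k + m" if "k + m < i" "i < n" for i
      using fg[of i] m(4)[of "i - k"] that by simp
    show "f j \<le> f i" if "k + m < i" "i < j" "j < n" for i j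
      using fg[of i] fg[of j] m(5)[of "i - k" "j - k"] that by simp
  qed simp
qed

text \<open>Mirror image of the right side under the reflection \<open>i\<close> to
  \<open>k - i\<close>, which is why the other two arcs of \<open>leaf_arc_neighbours\<close> are
  used.\<close>

lemma left_path:
  obtains lo where "lo \<le> k" "0 < k \<Longrightarrow> lo < k"
    "\<And>i. \<lbrakk>lo \<le> i; i < k\<rbrakk> \<Longrightarrow> f i = Suc i"
    "\<And>i. i < lo \<Longrightarrow> lo < f i"
    "\<And>i j. \<lbrakk>i < j; j < lo\<rbrakk> \<Longrightarrow> f j \<le> f i"
proof -
  define g where "g i = k - f (k - i)" for i
  have g: "f (k - i) = k - g i" "g i < i" "g i \<le> k" if "1 \<le> i" "i \<le> k" for i
    using left[of "k - i"] that by (auto simp: g_def)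
  have leaf: "x = k - g i"
    if i: "1 \<le> i" "i \<le> k" and nc: "\<And>j. \<lbrakk>1 \<le> j; j \<le> k\<rbrakk> \<Longrightarrow> g j \<noteq> i"
      and x: "x < n" "{p (k - i), p x} \<in> B" for i x
  proof -
    have "k - i < n" using root by simp
    then consider "x = f (k - i)" | "x \<noteq> k" "k - i = f x" using x edge_iff by blast
    then show ?thesis
    proof cases
      case 1
      then show ?thesis using g(1)[OF i] by simp
    next
      case 2
      then have "x < k" using right[of x] i x by (cases "k < x") auto
      then have "1 \<le> k - x" "k - x \<le> k" "k - (k - x) = x" by auto
      then show ?thesis using nc[of "k - x"] g(1,3)[of "k - x"] 2 i by simp
    qed
  qed
  have above: "g i \<le> g y"
    if i: "1 \<le> i" "i \<le> k" and nc: "\<And>j. \<lbrakk>1 \<le> j; j \<le> k\<rbrakk> \<Longrightarrow> g j \<noteq> i"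
      and y: "g i < y" "y < i" for i y
  proof -
    have n: "k - i < n" "k - g i < n" "k - y < n" using root by auto
    have l: "k - i < k - y" "k - y < k - g i" using i y by linarith+
    obtain q where q: "k - y < q" "q \<le> k - g i" "{p (k - y), p q} \<in> B"
      using leaf_arc_neighbours(3)[OF blocked n(1,2) leaf[OF i nc], of "k - y"] l by blast
    then consider "q = f (k - y)" | "q \<noteq> k" "k - y = f q" using edge_iff[OF n(3), of q] n by auto
    then show ?thesis
    proof cases
      case 1
      then show ?thesis using g(1)[of y] g(3)[of y] q i y by simp
    next
      case 2
      then have "q < k" using q by linarith
      then show ?thesis using left[of q] q 2 by linarith
    qed
  qed
  have below: "\<exists>y. x < y \<and> y \<le> g i \<and> g y = x"
    if i: "1 \<le> i" "i \<le> k" and nc: "\<And>j. \<lbrakk>1 \<le> j; j \<le> k\<rbrakk> \<Longrightarrow> g j \<noteq> i"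
      and x: "x < g i" for i x
  proof -
    have n: "k - i < n" "k - g i < n" "k - x < n" "k - i < k - g i" "k - g i < k - x"
      using i x g(2,3)[OF i] root by auto
    obtain q where q: "k - g i \<le> q" "q < k - x" "{p (k - x), p q} \<in> B"
      using leaf_arc_neighbours(4)[OF blocked n(1,2) leaf[OF i nc] n(4,5,3)] by auto
    then consider "k - x \<noteq> k" "q = f (k - x)" | "q \<noteq> k" "k - x = f q"
      using edge_iff[OF n(3), of q] n by auto
    then show ?thesis
    proof cases
      case 1
      then show ?thesis using left[of "k - x"] q n by simp
    next
      case 2
      then show ?thesis using q x g(3)[OF i]
        by (intro exI[of _ "k - q"]) (auto simp: g_def)
    qed
  qed
  obtain m where m: "m \<le> k" "1 \<le> k \<Longrightarrow> 1 \<le> m" "\<And>i. \<lbrakk>1 \<le> i; i \<le> m\<rbrakk> \<Longrightarrow> g i = i - 1"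
    "\<And>i. \<lbrakk>m < i; i \<le> k\<rbrakk> \<Longrightarrow> g i < m" "\<And>i j. \<lbrakk>m < i; i < j; j \<le> k\<rbrakk> \<Longrightarrow> g j \<le> g i"
  proof (rule path_and_leaves[of k g])
    show "g i < i" if "1 \<le> i" "i \<le> k" for i by (rule g(2)[OF that])
    show "g i \<le> g y" if "1 \<le> i" "i \<le> k" "\<And>j. \<lbrakk>1 \<le> j; j \<le> k\<rbrakk> \<Longrightarrow> g j \<noteq> i" "g i < y" "y < i" for i y
      by (rule above[OF that])
    show "\<exists>y. x < y \<and> y \<le> g i \<and> g y = x"
      if "1 \<le> i" "i \<le> k" "\<And>j. \<lbrakk>1 \<le> j; j \<le> k\<rbrakk> \<Longrightarrow> g j \<noteq> i" "x < g i" for i x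
      by (rule below[OF that])
  qed (rule that)
  have fg: "f i = k - g (k - i)" "1 \<le> k - i" "g (k - i) \<le> k" if "i < k" for i
    using g(1,3)[of "k - i"] that by auto
  show thesis
  proof (rule that[of "k - m"])
    show "k - m < k" if "0 < k" using m(1,2) that by simp
    show "f i = Suc i" if "k - m \<le> i" "i < k" for i
      using fg[of i] m(3)[of "k - i"] that by simp
    show "k - m < f i" if "i < k - m" for i
    proof -
      have "i < k" "m < k - i" "k - i \<le> k" using that by linarith+
      then show ?thesis using fg(1)[of i] m(1) m(4)[of "k - i"] by linarith
    qed
    show "f j \<le> f i" if "i < j" "j < k - m" for i j
    proof -
      have "i < k" "j < k" "m < k - j" "k - j < k - i" "k - i \<le> k" using that by linarith+
      then show ?thesis
        using fg(1)[of i] fg(1)[of j] m(5)[of "k - j" "k - i"] by linarith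
    qed
  qed simp
qed

text \<open>The boundary path runs from \<open>lo\<close> to \<open>hi\<close>, and the remaining
  vertices hang on its interior as leaves with nested edges. The assumptions on \<open>k\<close>
  keep edges of \<open>B\<close> from wrapping around, except that for two vertices the closing edge
  already joins consecutive indices.\<close>

lemma comb_edges:
  assumes k: "0 < k" "k < n - 1 \<or> n = 2"
  shows "comb (p ` {..<n}) B"
proof -
  let ?V = "p ` {..<n}"
  obtain hi where hi: "k \<le> hi" "hi < n" "k < n - 1 \<Longrightarrow> k < hi"
    and hi_path: "\<And>i. \<lbrakk>k < i; i \<le> hi\<rbrakk> \<Longrightarrow> f i = i - 1"
    and hi_leaf: "\<And>i. \<lbrakk>hi < i; i < n\<rbrakk> \<Longrightarrow> f i < hi"
    and hi_mono: "\<And>i j. \<lbrakk>hi < i; i < j; j < n\<rbrakk> \<Longrightarrow> f j \<le> f i"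
    using right_path by metis
  obtain lo where lo: "lo \<le> k" "0 < k \<Longrightarrow> lo < k"
    and lo_path: "\<And>i. \<lbrakk>lo \<le> i; i < k\<rbrakk> \<Longrightarrow> f i = Suc i"
    and lo_leaf: "\<And>i. i < lo \<Longrightarrow> lo < f i"
    and lo_mono: "\<And>i j. \<lbrakk>i < j; j < lo\<rbrakk> \<Longrightarrow> f j \<le> f i"
    using left_path by metis
  have "lo < k" using lo k by simp
  have edge_cases: thesis
    if "e \<in> B" "\<And>i. \<lbrakk>i < n; i \<noteq> k; e = {p i, p (f i)}\<rbrakk> \<Longrightarrow> thesis" for e thesis
    using that unfolding edges by blast
  have edge: "{p i, p (f i)} \<in> B" if "i < n" "i \<noteq> k" for i
    unfolding edges using that by blast
  \<comment> \<open>No edge separates the ends of another, touching allowed: opposite sides meet at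
    most at the root, path edges enclose no index, and leaf edges are nested by monotonicity. Both
    kinds of crossing are excluded by this.\<close>
  have nested: "{j, f j} \<subseteq> {min i (f i)..max i (f i)} \<or> {j, f j} \<inter> {min i (f i)<..<max i (f i)} = {}"
    if i: "i < n" "i \<noteq> k" and j: "j < n" "j \<noteq> k" for i j
  proof (cases "k < i")
    case True
    note ri = right[OF True i(1)]
    have "f i \<le> j \<and> j \<le> i \<and> f i \<le> f j \<and> f j \<le> i \<or>
        \<not> (f i < j \<and> j < i) \<and> \<not> (f i < f j \<and> f j < i)"
    proof (cases "k < j")
      case False
      then have "j < k" using j by simp
      then show ?thesis using left[of j] ri by linarith
    next
      case kj: True
      note rj = right[OF kj j(1)]
      consider "i \<le> hi" | "hi < i" "j \<le> hi" | "hi < i" "hi < j" "j < i" | "i = j" | "hi < i" "i < j"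
        by linarith
      then show ?thesis
      proof cases
        case 1
        then show ?thesis using hi_path[OF True] by linarith
      next
        case 2
        then show ?thesis using hi_path[OF kj] hi_leaf[of i] i kj by linarith
      next
        case 3
        then show ?thesis using hi_mono[of j i] i rj by linarith
      next
        case 4
        then show ?thesis using ri by simp
      next
        case 5
        then show ?thesis using hi_mono[of i j] j by linarith
      qed
    qed
    moreover have "min i (f i) = f i" "max i (f i) = i" using ri by auto
    ultimately show ?thesis by auto
  next
    case False
    then have ik: "i < k" using i by simp
    note ri = left[OF ik]
    have "i \<le> j \<and> j \<le> f i \<and> i \<le> f j \<and> f j \<le> f i \<or>
        \<not> (i < j \<and> j < f i) \<and> \<not> (i < f j \<and> f j < f i)"
    proof (cases "j < k")
      case False
      then have "k < j" using j by simp
      then show ?thesis using right[of j] j ri by linarith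
    next
      case kj: True
      note rj = left[OF kj]
      consider "lo \<le> i" | "i < lo" "lo \<le> j" | "i < lo" "j < lo" "i < j" | "i = j" | "i < lo" "j < i"
        by linarith
      then show ?thesis
      proof cases
        case 1
        then show ?thesis using lo_path[OF _ ik] by linarith
      next
        case 2
        then show ?thesis using lo_path[OF _ kj] lo_leaf[of i] by linarith
      next
        case 3
        then show ?thesis using lo_mono[of i j] rj by linarith
      next
        case 4
        then show ?thesis using ri by simp
      next
        case 5
        then show ?thesis using lo_mono[of j i] by linarith
      qed
    qed
    moreover have "min i (f i) = i" "max i (f i) = f i" using ri by auto
    ultimately show ?thesis by auto
  qed
  have no_line_cross: "\<not> line_crosses e e'" if e: "e \<in> B" "e' \<in> B" for e e'
  proof -
    obtain i where i: "i < n" "i \<noteq> k" "e = {p i, p (f i)}" using edge_cases e(1) by blast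
    obtain j where j: "j < n" "j \<noteq> k" "e' = {p j, p (f j)}" using edge_cases e(2) by blast
    show ?thesis unfolding i(3) j(3)
      by (rule chords_not_line_cross)
        (use i j parent_less[of i] parent_less[of j] parent_neq[of i] nested[of i j] in simp_all)
  qed
  have no_cross: "\<not> seg_cross e e'" if e: "e \<in> B" "e' \<in> B" for e e'
  proof -
    obtain i where i: "i < n" "i \<noteq> k" "e = {p i, p (f i)}" using edge_cases e(1) by blast
    obtain j where j: "j < n" "j \<noteq> k" "e' = {p j, p (f j)}" using edge_cases e(2) by blast
    show ?thesis
    proof (cases "{i, f i} \<inter> {j, f j} = {}")
      case True
      have "j \<noteq> i" "j \<noteq> f i" "f j \<noteq> i" "f j \<noteq> f i" using True by auto
      then have "min i (f i) < j \<and> j < max i (f i) \<longleftrightarrow> min i (f i) < f j \<and> f j < max i (f i)"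
        using nested[OF i(1,2) j(1,2)] by (auto simp: min_def max_def)
      then show ?thesis
        unfolding i(3) j(3)
        by (intro chords_not_cross)
          (use i j True parent_less[of i] parent_less[of j] parent_neq[of i] in simp_all)
    next
      case False
      then obtain l where "l \<in> {i, f i}" "l \<in> {j, f j}" by blast
      then have "p l \<in> e" "p l \<in> e'" unfolding i(3) j(3) by auto
      then show ?thesis by (rule not_seg_cross_common)
    qed
  qed
  have "B \<subseteq> complete_edges ?V"
  proof
    fix e assume "e \<in> B"
    then obtain i where i: "i < n" "i \<noteq> k" "e = {p i, p (f i)}" using edge_cases by blast
    then show "e \<in> complete_edges ?V"
      using parent_less[of i] parent_neq[of i] by (simp add: complete_edges_iff p_eq_iff)
  qed
  moreover have "B \<inter> boundary_edges ?V = path_edges (map p [lo..<Suc hi])"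
    unfolding path_edges_map_upt
  proof (intro equalityI subsetI)
    fix e assume e: "e \<in> B \<inter> boundary_edges ?V"
    then obtain i where i: "i < n" "i \<noteq> k" "e = {p i, p (f i)}" using edge_cases by blast
    show "e \<in> (\<lambda>i. {p i, p (Suc i)}) ` {lo..<hi}"
    proof (cases "k < i")
      case True
      then have r: "k \<le> f i" "f i < i" using right i by auto
      have "{p (f i), p i} \<in> boundary_edges ?V" using e i by (simp add: insert_commute)
      \<comment> \<open>The closing edge would need \<open>f i = 0\<close>, but \<open>f i\<close>
        is at least \<open>k\<close>, which is positive.\<close>
      then have "i = Suc (f i)" using boundary_edge_iff[OF r(2) i(1)] r k by auto
      moreover have "f i < hi" using hi_leaf[of i] i \<open>i = Suc (f i)\<close> by (cases "hi < i") auto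
      moreover have "e = {p (f i), p (Suc (f i))}"
        using i(3) \<open>i = Suc (f i)\<close> by (simp add: insert_commute)
      ultimately show ?thesis using r \<open>lo < k\<close> by auto
    next
      case False
      then have ik: "i < k" using i by simp
      then have l: "i < f i" "f i \<le> k" "f i < n" using left root by fastforce+
      have "f i = Suc i \<or> i = 0 \<and> f i = n - 1"
        using boundary_edge_iff[OF l(1,3)] e i by simp
      then have s: "f i = Suc i" using k l by auto
      have "lo \<le> i" using lo_leaf[of i] s by (cases "i < lo") auto
      then show ?thesis using ik s i(3) hi by auto
    qed
  next
    fix e assume "e \<in> (\<lambda>i. {p i, p (Suc i)}) ` {lo..<hi}"
    then obtain i where i: "lo \<le> i" "i < hi" "e = {p i, p (Suc i)}" by auto
    have "e \<in> B"
    proof (cases "i < k")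
      case True
      then show ?thesis using edge[of i] lo_path[of i] i root by simp
    next
      case False
      then show ?thesis using edge[of "Suc i"] hi_path[of "Suc i"] i hi by (simp add: insert_commute)
    qed
    moreover have "e \<in> boundary_edges ?V"
      using boundary_edge_iff[of i "Suc i"] i hi by simp
    ultimately show "e \<in> B \<inter> boundary_edges ?V" by blast
  qed
  moreover have "\<exists>!e. e \<in> B \<and> (\<exists>w\<in>interior_vertices (map p [lo..<Suc hi]). e = {v, w})"
    if v: "v \<in> ?V - set (map p [lo..<Suc hi])" for v
    unfolding interior_vertices_map_upt
  proof -
    obtain i where i: "i < n" "v = p i" using v by blast
    have "i < lo \<or> hi < i"
    proof (rule ccontr)
      assume "\<not> ?thesis"
      then have "lo \<le> i \<and> i < Suc hi" by linarith
      then have "i \<in> set [lo..<Suc hi]" unfolding set_upt by simp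
      then have "v \<in> set (map p [lo..<Suc hi])" unfolding set_map i(2) by (rule imageI)
      then show False using v by blast
    qed
    then have ik: "i \<noteq> k" using lo hi by auto
    \<comment> \<open>Either the root is interior to the path, which makes all parents of outside
      vertices interior, or the path covers all vertices.\<close>
    have "k < hi \<or> lo = 0 \<and> hi = n - 1" using hi k \<open>lo < k\<close> by auto
    then have fi: "lo < f i" "f i < hi"
      using \<open>i < lo \<or> hi < i\<close> lo_leaf[of i] hi_leaf[of i] left[of i] right[of i] i lo hi \<open>lo < k\<close>
      by auto
    show "\<exists>!e. e \<in> B \<and> (\<exists>w\<in>p ` {lo<..<hi}. e = {v, w})"
    proof (rule ex1I[of _ "{v, p (f i)}"])
      show "{v, p (f i)} \<in> B \<and> (\<exists>w\<in>p ` {lo<..<hi}. {v, p (f i)} = {v, w})"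
        using edge[OF i(1) ik] fi i(2) by (intro conjI bexI[of _ "p (f i)"] imageI) simp_all
      fix e assume "e \<in> B \<and> (\<exists>w\<in>p ` {lo<..<hi}. e = {v, w})"
      then obtain w where w: "lo < w" "w < hi" "{p i, p w} \<in> B" "e = {p i, p w}"
        unfolding i(2) by (metis (no_types, lifting) greaterThanLessThan_iff imageE)
      have "w < n" using w hi by simp
      then consider "w = f i" | "w \<noteq> k" "i = f w" using edge_iff[OF i(1)] w(3) by blast
      then show "e = {v, p (f i)}"
      proof cases
        case 2
        \<comment> \<open>The parent of a path vertex is the next path vertex towards the root, so
          it cannot be the vertex \<open>i\<close> outside the path.\<close>
        then have "k < w \<Longrightarrow> i = w - 1" "w < k \<Longrightarrow> i = Suc w"
          using hi_path[of w] lo_path[of w] w by auto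
        then show ?thesis using 2(1) w \<open>i < lo \<or> hi < i\<close> lo hi by linarith
      qed (use w i in simp)
    qed
  qed
  moreover have "distinct (map p [lo..<Suc hi])" "set (map p [lo..<Suc hi]) \<subseteq> ?V"
    "map p [lo..<Suc hi] \<noteq> []"
  proof -
    have sub: "{lo..<Suc hi} \<subseteq> {..<n}" using hi by auto
    show "distinct (map p [lo..<Suc hi])"
      unfolding distinct_map set_upt using inj_on_subset[OF inj sub] by simp
    show "set (map p [lo..<Suc hi]) \<subseteq> ?V" unfolding set_map set_upt by (rule image_mono[OF sub])
    show "map p [lo..<Suc hi] \<noteq> []" using lo hi by simp
  qed
  ultimately show ?thesis
    unfolding comb_def simple_geo_def using no_cross no_line_cross
    by (intro conjI exI[of _ "map p [lo..<Suc hi]"] ballI) assumption+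
qed

end

section \<open>From a leaf to the tree of parents\<close>

context ccw_polygon
begin

text \<open>With the leaf \<open>v\<close> at an end of the numbering, arcs avoiding it are
  intervals. Each vertex other than \<open>k\<close> thus gets a parent towards \<open>k\<close>,
  and these \<open>n - 1\<close> edges exhaust \<open>B\<close> by the bound on its size.\<close>

lemma comb_if_leaf:
  assumes blk: "blocks (trees_le (p ` {..<n}) 3) B" and B: "finite B" "card B \<le> n - 1"
    and v: "v = 0 \<or> v = n - 1" "v < n"
    and k: "0 < k" "k < n" "k \<noteq> v" "k < n - 1 \<or> n = 2"
    and vk: "{p v, p k} \<in> B" and leaf: "\<And>x. \<lbrakk>x < n; {p v, p x} \<in> B\<rbrakk> \<Longrightarrow> x = k"
  shows "comb (p ` {..<n}) B"
proof -
  have "\<exists>q. {p i, p q} \<in> B \<and> (k < i \<longrightarrow> k \<le> q \<and> q < i) \<and> (i < k \<longrightarrow> i < q \<and> q \<le> k)"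
    if i: "i < n" "i \<noteq> k" for i
  proof (cases "i = v")
    case True
    then show ?thesis using vk by (intro exI[of _ k]) auto
  next
    case False
    note nb = leaf_arc_neighbours[OF blk v(2) k(2) leaf, of i]
    consider "k < i" "v = 0" | "k < i" "v = n - 1" | "i < k" "v = 0" | "i < k" "v = n - 1"
      using v i by linarith
    then show ?thesis
    proof cases
      case 1
      then show ?thesis using nb(4) i k by auto
    next
      case 2
      then have "i < v" using i False by linarith
      then show ?thesis using nb(1) 2 by auto
    next
      case 3
      then show ?thesis using nb(3) False by auto
    next
      case 4
      then have "k < v" using k by linarith
      then show ?thesis using nb(2) 4 by auto
    qed
  qed
  then have "\<forall>i\<in>{..<n} - {k}. \<exists>q. {p i, p q} \<in> B \<and>
      (k < i \<longrightarrow> k \<le> q \<and> q < i) \<and> (i < k \<longrightarrow> i < q \<and> q \<le> k)"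
    by simp
  from bchoice[OF this] obtain f where f: "\<And>i. \<lbrakk>i < n; i \<noteq> k\<rbrakk> \<Longrightarrow>
      {p i, p (f i)} \<in> B \<and> (k < i \<longrightarrow> k \<le> f i \<and> f i < i) \<and> (i < k \<longrightarrow> i < f i \<and> f i \<le> k)"
    by auto
  let ?E = "(\<lambda>i. {p i, p (f i)}) ` ({..<n} - {k})"
  have "inj_on (\<lambda>i. {p i, p (f i)}) ({..<n} - {k})"
  proof (rule inj_onI)
    fix i j assume ij: "i \<in> {..<n} - {k}" "j \<in> {..<n} - {k}" "{p i, p (f i)} = {p j, p (f j)}"
    then have n: "i < n" "j < n" "i \<noteq> k" "j \<noteq> k" by auto
    note fi = f[OF n(1,3)] and fj = f[OF n(2,4)]
    have fn: "f i < n" "f j < n" using fi fj n k(2) by linarith+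
    \<comment> \<open>The second alternative would make \<open>i\<close> and \<open>j\<close>
      parents of each other, although parents move strictly towards \<open>k\<close>.\<close>
    have "i = j \<or> i = f j \<and> f i = j"
      using ij(3) n fn by (auto simp: doubleton_eq_iff p_eq_iff)
    then show "i = j" using fi fj n by linarith
  qed
  then have "card ?E = n - 1" using k(2) by (simp add: card_image)
  moreover have "?E \<subseteq> B" using f by auto
  ultimately have E: "B = ?E" using card_seteq[OF B(1), of ?E] B(2) by simp
  interpret blocked_polygon p n B k f
  proof unfold_locales
    show "k \<le> f i \<and> f i < i" if "k < i" "i < n" for i using f[of i] that by simp
    show "i < f i \<and> f i \<le> k" if "i < k" for i using f[of i] that k by simp
  qed (fact blk k(2) E)+
  show ?thesis by (rule comb_edges[OF k(1,4)])
qed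

end

text \<open>
  Used when the neighbour of the leaf \<open>p 0\<close> is \<open>p (n - 1)\<close>: renumbering turns the edge between
  them into one of consecutive indices, so that no edge of \<open>B\<close> wraps around.
\<close>

lemma ccw_polygon_rotate:
  assumes "ccw_polygon p n" "0 < n"
  shows "ccw_polygon (\<lambda>i. if i = n - 1 then p 0 else p (Suc i)) n"
    and "(\<lambda>i. if i = n - 1 then p 0 else p (Suc i)) ` {..<n} = p ` {..<n}"
proof -
  interpret ccw_polygon p n by fact
  let ?q = "\<lambda>i. if i = n - 1 then p 0 else p (Suc i)"
  show "ccw_polygon ?q n"
  proof
    show "inj_on ?q {..<n}"
      by (rule inj_onI) (auto simp: p_eq_iff split: if_splits)
    show "0 < orient (?q i) (?q j) (?q k)" if "i < j" "j < k" "k < n" for i j k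
      using that ccw[of "Suc i" "Suc j" "Suc k"] ccw[of 0 "Suc i" "Suc j"]
        orient_rotate[of "p (Suc i)" "p (Suc j)" "p 0"]
      by auto
  qed
  show "?q ` {..<n} = p ` {..<n}"
  proof (intro equalityI subsetI)
    fix x assume "x \<in> ?q ` {..<n}"
    then obtain i where i: "i < n" "x = ?q i" by blast
    show "x \<in> p ` {..<n}"
    proof (cases "i = n - 1")
      case True
      then show ?thesis using i assms(2) by simp
    next
      case False
      then have "Suc i < n" "x = p (Suc i)" using i by auto
      then show ?thesis by simp
    qed
  next
    fix x assume "x \<in> p ` {..<n}"
    then obtain i where i: "i < n" "x = p i" by blast
    show "x \<in> ?q ` {..<n}"
    proof (cases i)
      case 0
      then show ?thesis using i assms(2) by (intro image_eqI[of _ _ "n - 1"]) auto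
    next
      case (Suc j)
      then show ?thesis using i by (intro image_eqI[of _ _ j]) auto
    qed
  qed
qed

text \<open>A walk in the tree from \<open>v\<close> to another vertex starts with an edge of the
  star. This bounds the size of a blocker by the number of edges of a star.\<close>

lemma star_blocks_trees_le:
  assumes v: "v \<in> V" "a \<in> V" "a \<noteq> v"
  shows "blocks (trees_le V k) ((\<lambda>x. {v, x}) ` (V - {v}))"
  unfolding blocks_def
proof
  fix T assume T: "T \<in> trees_le V k"
  then have "graph_connected V T" "T \<subseteq> complete_edges V"
    by (auto simp: trees_le_def spanning_tree_def)
  then obtain xs where xs: "walk T xs" "hd xs = v" "last xs = a"
    using v unfolding graph_connected_def by blast
  obtain x ys where "xs = v # x # ys"
    using xs v by (cases xs; cases "tl xs") (auto simp: walk_def)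
  then have "{v, x} \<in> T" using xs by simp
  moreover from this have "x \<in> V - {v}"
    using \<open>T \<subseteq> complete_edges V\<close> complete_edges_iff[of v x V] by blast
  ultimately show "(\<lambda>x. {v, x}) ` (V - {v}) \<inter> T \<noteq> {}" by blast
qed

theorem theorem3:
  fixes V :: "(real \<times> real) set" and B :: "(real \<times> real) set set"
  assumes "finite V"
    and "general_position V"
    and "convex_position V"
    and "B \<subseteq> complete_edges V"
    and "is_blocker V (trees_le V 3) B"
  shows "comb V B"
proof -
  define n where "n = card V"
  have blk: "blocks (trees_le V 3) B"
    and least: "\<And>B'. \<lbrakk>B' \<subseteq> complete_edges V; blocks (trees_le V 3) B'\<rbrakk> \<Longrightarrow> card B \<le> card B'"
    using assms(5) unfolding is_blocker_def by blast+
  have "B \<subseteq> Pow V" using assms(4) unfolding complete_edges_def by blast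
  then have finB: "finite B" using assms(1) finite_subset by blast
  have other: "\<exists>b\<in>V. b \<noteq> a" if "a \<in> V" for a
  proof (rule ccontr)
    assume "\<not> ?thesis"
    then have V: "V = {a}" using that by blast
    have "walk {} [a]" by simp
    then have con: "\<exists>xs. walk {} xs \<and> hd xs = a \<and> last xs = a \<and> length xs \<le> 3 + 1"
      by (intro exI[of _ "[a]"]) simp
    \<comment> \<open>On a single vertex the empty tree belongs to the family and no edge set can
      meet it; hence there are at least two vertices.\<close>
    then have "{} \<in> trees_le V 3"
      unfolding V trees_le_def spanning_tree_def graph_connected_def diameter_le_def
        simple_geo_def has_cycle_def by auto
    then show False using blk unfolding blocks_def by blast
  qed
  have "V \<noteq> {}"
  proof
    assume "V = {}"
    then have "{} \<in> trees_le V 3"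
      by (auto simp: trees_le_def spanning_tree_def graph_connected_def diameter_le_def
        simple_geo_def has_cycle_def)
    then show False using blk unfolding blocks_def by blast
  qed
  then obtain s t where s: "s \<in> V" "t \<in> V" "t \<noteq> s" using other by blast
  then have "card {s, t} \<le> n" unfolding n_def using assms(1) by (intro card_mono) auto
  then have n2: "2 \<le> n" using s by simp
  have "card B \<le> card ((\<lambda>x. {s, x}) ` (V - {s}))"
  proof (rule least)
    show "blocks (trees_le V 3) ((\<lambda>x. {s, x}) ` (V - {s}))"
      by (rule star_blocks_trees_le) (use s in auto)
    show "(\<lambda>x. {s, x}) ` (V - {s}) \<subseteq> complete_edges V"
      using s by (auto simp: complete_edges_iff)
  qed
  also have "\<dots> \<le> card (V - {s})" by (rule card_image_le) (use assms(1) in simp)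
  also have "\<dots> = n - 1" using s by (simp add: n_def)
  finally have card: "card B \<le> n - 1" .
  have nb: "\<exists>e\<in>B. a \<in> e" if a: "a \<in> V" for a
  proof -
    obtain b where "b \<in> V" "b \<noteq> a" using other a by blast
    then obtain x where "{a, x} \<in> B"
      using blocks_trees_le_no_isolated_vertex[OF blk a, of b] by blast
    then show ?thesis by blast
  qed
  obtain v u where v: "v \<in> V" and u: "u \<in> V" "u \<noteq> v" "{v, u} \<in> B"
    and leaf: "\<And>x. {v, x} \<in> B \<Longrightarrow> x = u"
  proof (rule exists_leaf[OF assms(1,4)])
    show "card B < card V" using card n2 unfolding n_def by linarith
    show "\<exists>e\<in>B. a \<in> e" if "a \<in> V" for a by (rule nb[OF that])
  qed (rule that)
  obtain p where p: "ccw_polygon p n" "p ` {..<n} = V" "p 0 = v"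
    unfolding n_def by (rule convex_position_enumeration[OF assms(1-3) v])
  obtain k where k: "k < n" "u = p k" using u(1) p(2) by blast
  have "k \<noteq> 0"
  proof
    assume "k = 0"
    then show False using k(2) p(3) u(2) by simp
  qed
  show ?thesis
  proof (cases "k < n - 1 \<or> n = 2")
    case True
    have "comb (p ` {..<n}) B"
    proof (rule ccw_polygon.comb_if_leaf[OF p(1), of B 0 k])
      show "x = k" if "x < n" "{p 0, p x} \<in> B" for x
        using leaf[of "p x"] that k p(3) ccw_polygon.p_eq_iff[OF p(1) that(1) k(1)] by simp
    qed (use blk finB card n2 k u p True \<open>k \<noteq> 0\<close> in simp_all)
    then show ?thesis using p(2) by simp
  next
    case False
    \<comment> \<open>Here \<open>k = n - 1\<close> and \<open>n\<close> is at least 3, so after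
      rotation the leaf has index \<open>n - 1\<close> and its neighbour the positive index
      \<open>n - 2\<close>.\<close>
    define q where "q = (\<lambda>i. if i = n - 1 then p 0 else p (Suc i))"
    have q: "ccw_polygon q n" "q ` {..<n} = V"
      unfolding q_def using ccw_polygon_rotate[OF p(1)] p(2) n2 by simp_all
    have qv: "q (n - 1) = v" "q (n - 2) = u"
    proof -
      have "Suc (n - 2) = k" "n - 2 \<noteq> n - 1" using False k n2 by linarith+
      then show "q (n - 1) = v" "q (n - 2) = u" using p(3) k(2) by (simp_all add: q_def)
    qed
    have n: "n - 2 < n" "n - 1 < n" "0 < n - 2" "n - 2 \<noteq> n - 1" "n - 2 < n - 1"
      using n2 False by linarith+
    have "comb (q ` {..<n}) B"
    proof (rule ccw_polygon.comb_if_leaf[OF q(1), of B "n - 1" "n - 2"])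
      show "x = n - 2" if "x < n" "{q (n - 1), q x} \<in> B" for x
        using leaf[of "q x"] that qv ccw_polygon.p_eq_iff[OF q(1) that(1) n(1)] by simp
      show "blocks (trees_le (q ` {..<n}) 3) B" using blk q(2) by simp
      show "{q (n - 1), q (n - 2)} \<in> B" using u qv by simp
    qed (use finB card n in simp_all)
    then show ?thesis using q(2) by simp
  qed
qed

end
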